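(* Let $p\in(0,1)$ and let $b_0,b_1$ be reals such that $e^{b_0},e^{b_1}$ are even integers with $2\le e^{b_0}<e^{b_1}<\infty$. Let $N$ be a random variable taking the value $e^{b_0}$ with probability $p$ and $e^{b_1}$ with probability $1-p$, and let $Z=(Z_n)_{n\ge0}$ be the branching random walk with reproduction law $Z_1 := N\big(\tfrac12\delta_{-1}+\tfrac12\delta_{+1}\big)$. Let $\gamma$ be the function on $[b_0,b_1]$ defined in the context. Then for any $b\in[b_0,b_1]$, $n\ge1$ and $\zeta\in\mathcal{Z}_n(b)$, $$n^{-1}\langle\bar\zeta,x\rangle\le\gamma(b).$$ On the other hand, for any $\epsilon>0$ and $b\in[b_0,b_1]$, there are $n\ge1$ and $\zeta\in\mathcal{Z}_n$ such that $$n^{-1}\langle\bar\zeta,x\rangle\ge\gamma(b)-\epsilon\quad\text{and}\quad n^{-1}\log|\zeta|\in[b-\epsilon,b+\epsilon].$$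
   Context: Notation. For a Borel measure $\zeta$ on $\mathbb{R}$, $|\zeta| := \zeta(\mathbb{R})$, $\langle \zeta, x\rangle := \int x\,\zeta(dx)$, and $\bar\zeta := \zeta/|\zeta|$. For a finite point measure $\zeta$, $(x : x\in\zeta)$ lists its atoms, each atom $x$ repeated $\zeta(\{x\})$ times, repetitions counting as different indices. Branching random walk. $Z=(Z_n)_{n\ge0}$ is a sequence of random point measures on $\mathbb{R}$ with $Z_0=\delta_0$, $Z_1$ distributed according to the given reproduction law, and, for $n\ge2$, conditionally on $Z_0,\dots,Z_{n-1}$, $Z_n$ is distributed as $\sum_{x\in Z_{n-1}} Z_1^{(x)}(\cdot - x)$, where the $Z_1^{(x)}$, $x\in Z_{n-1}$, are independent copies of $Z_1$. $\mathcal{Z}_n := \{\zeta : \mathbb{P}(Z_n=\zeta)>0\}$ and $\mathcal{Z}_n(b) := \{\zeta\in\mathcal{Z}_n : |\zeta|=e^{bn}\}$ (possibly empty). $\beta:[0,1]\to[0,\log2]$ is the function $\beta(x) := \tfrac12\big((1+x)\log(1+x)+(1-x)\log(1-x)\big)$ (with $0\log 0=0$), which is a strictly increasing bijection, and $$\gamma(b) := \begin{cases}0, & b=b_0,\\ \beta^{-1}\big((b_1-b)\wedge\log2\big), & b\in(b_0,b_1].\end{cases}$$ *)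

theory Defs
  imports "HOL-Probability.Probability"
begin

text \<open>
  A finite point measure on the real line is encoded as the multiset of its atoms, and
  \<open>atoms_measure\<close> is the Borel measure \<open>\<Sum>x\<in>\<zeta>. \<delta>\<^sub>x\<close> it stands for
  (see \<open>emeasure_atoms_measure\<close>).
\<close>

definition atoms_measure :: "real multiset \<Rightarrow> real measure" where
  "atoms_measure \<zeta> =
     distr (point_measure (set_mset \<zeta>) (\<lambda>x. of_nat (count \<zeta> x))) borel (\<lambda>x. x)"

lemma sets_atoms_measure [simp, measurable_cong]: "sets (atoms_measure \<zeta>) = sets borel"
  by (simp add: atoms_measure_def)

lemma space_atoms_measure [simp]: "space (atoms_measure \<zeta>) = UNIV"
  by (simp add: atoms_measure_def)

lemma emeasure_atoms_measure:
  assumes "A \<in> sets borel"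
  shows "emeasure (atoms_measure \<zeta>) A = of_nat (size (filter_mset (\<lambda>x. x \<in> A) \<zeta>))"
proof -
  have "emeasure (atoms_measure \<zeta>) A
      = emeasure (point_measure (set_mset \<zeta>) (\<lambda>x. of_nat (count \<zeta> x))) (A \<inter> set_mset \<zeta>)"
    unfolding atoms_measure_def using assms
    by (subst emeasure_distr) (auto simp: space_point_measure)
  also have "\<dots> = (\<Sum>x\<in>A \<inter> set_mset \<zeta>. of_nat (count \<zeta> x))"
    by (intro emeasure_point_measure_finite) auto
  also have "\<dots> = of_nat (\<Sum>x\<in>A \<inter> set_mset \<zeta>. count \<zeta> x)"
    by simp
  also have "(\<Sum>x\<in>A \<inter> set_mset \<zeta>. count \<zeta> x) = size (filter_mset (\<lambda>x. x \<in> A) \<zeta>)"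
    by (auto simp: size_multiset_overloaded_eq Int_commute Collect_conj_eq intro!: sum.cong)
  finally show ?thesis .
qed

definition total_mass :: "real measure \<Rightarrow> real" where
  "total_mass \<zeta> = measure \<zeta> UNIV"

definition first_moment :: "real measure \<Rightarrow> real" where
  "first_moment \<zeta> = (\<integral>x. x \<partial>\<zeta>)"

definition normalized :: "real measure \<Rightarrow> real measure" where
  "normalized \<zeta> = scale_measure (1 / emeasure \<zeta> UNIV) \<zeta>"

text \<open>
  The atoms of \<open>\<zeta>\<close>, a repeated atom giving distinct indices, and the law of
  \<open>\<Sum>x\<in>\<zeta>. Z\<^sub>1\<^sup>x(\<cdot> - x)\<close> for independent \<open>Z\<^sub>1\<^sup>x\<close> with law \<open>R\<close>: the measure
  \<open>\<xi>(\<cdot> - x)\<close> is \<open>\<xi>\<close> with all its atoms translated by \<open>x\<close>.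
\<close>

definition atom_indices :: "real multiset \<Rightarrow> (real \<times> nat) set" where
  "atom_indices \<zeta> = {(x, i). x \<in># \<zeta> \<and> i < count \<zeta> x}"

definition offspring_law :: "real multiset pmf \<Rightarrow> real multiset \<Rightarrow> real multiset pmf" where
  "offspring_law R \<zeta> =
     map_pmf (\<lambda>\<xi>. \<Sum>j\<in>atom_indices \<zeta>. image_mset (\<lambda>y. y + fst j) (\<xi> j))
       (Pi_pmf (atom_indices \<zeta>) {#} (\<lambda>_. R))"

text \<open>
  \<open>random_point_measure\<close> is measurability with respect to the usual \<open>\<sigma>\<close>-algebra on point
  measures, generated by the evaluations \<open>\<zeta> \<mapsto> \<zeta>(A)\<close> for Borel \<open>A\<close>.
\<close>

definition random_point_measure :: "'w measure \<Rightarrow> ('w \<Rightarrow> real multiset) \<Rightarrow> bool" where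
  "random_point_measure M X \<longleftrightarrow>
     (\<forall>A\<in>sets borel. (\<lambda>\<omega>. emeasure (atoms_measure (X \<omega>)) A) \<in> borel_measurable M)"

text \<open>
  The reproduction law \<open>R\<close> is discrete, hence so is the law of \<open>(Z\<^sub>0, \<dots>, Z\<^sub>n)\<close>, and
  conditioning on \<open>Z\<^sub>0, \<dots>, Z\<^sub>n\<^sub>-\<^sub>1\<close> is elementary conditioning on each history of positive
  probability.
\<close>

definition branching_random_walk ::
  "'w measure \<Rightarrow> real multiset pmf \<Rightarrow> (nat \<Rightarrow> 'w \<Rightarrow> real multiset) \<Rightarrow> bool" where
  "branching_random_walk M R Z \<longleftrightarrow>
     prob_space M \<and>
     (\<forall>n. random_point_measure M (Z n)) \<and>
     (AE \<omega> in M. Z 0 \<omega> = {#0#}) \<and>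
     (\<forall>\<zeta>. \<P>(\<omega> in M. Z 1 \<omega> = \<zeta>) = pmf R \<zeta>) \<and>
     (\<forall>n\<ge>2. \<forall>h. \<P>(\<omega> in M. \<forall>k<n. Z k \<omega> = h k) > 0 \<longrightarrow>
        (\<forall>\<zeta>. \<P>(\<omega> in M. Z n \<omega> = \<zeta> \<bar> \<forall>k<n. Z k \<omega> = h k)
             = pmf (offspring_law R (h (n - 1))) \<zeta>))"

definition attainable ::
  "'w measure \<Rightarrow> (nat \<Rightarrow> 'w \<Rightarrow> real multiset) \<Rightarrow> nat \<Rightarrow> real multiset set" where
  "attainable M Z n = {\<zeta>. \<P>(\<omega> in M. Z n \<omega> = \<zeta>) > 0}"

definition attainable_of_rate ::
  "'w measure \<Rightarrow> (nat \<Rightarrow> 'w \<Rightarrow> real multiset) \<Rightarrow> nat \<Rightarrow> real \<Rightarrow> real multiset set" where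
  "attainable_of_rate M Z n b =
     {\<zeta> \<in> attainable M Z n. total_mass (atoms_measure \<zeta>) = exp (b * real n)}"

text \<open>The law of \<open>N (\<delta>\<^sub>-\<^sub>1 + \<delta>\<^sub>1) / 2\<close>, for \<open>N\<close> supported on even numbers.\<close>

definition balanced_reproduction :: "nat pmf \<Rightarrow> real multiset pmf" where
  "balanced_reproduction N =
     map_pmf (\<lambda>k. replicate_mset (k div 2) (-1) + replicate_mset (k div 2) 1) N"

text \<open>The convention \<open>0 log 0 = 0\<close> holds automatically, at \<open>x = 1\<close>.\<close>

definition \<beta> :: "real \<Rightarrow> real" where
  "\<beta> x = ((1 + x) * ln (1 + x) + (1 - x) * ln (1 - x)) / 2"

text \<open>Only the values on \<open>[b\<^sub>0, b\<^sub>1]\<close> matter.\<close>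

definition \<gamma> :: "real \<Rightarrow> real \<Rightarrow> real \<Rightarrow> real" where
  "\<gamma> b\<^sub>0 b\<^sub>1 b =
     (if b = b\<^sub>0 then 0 else the_inv_into {0..1} \<beta> (min (b\<^sub>1 - b) (ln 2)))"

end

theory Submission
  imports Defs "HOL-Real_Asymp.Real_Asymp"
begin

text \<open>
  \<^emph>\<open>Upper bound.\<close> For any \<open>\<theta> \<ge> 0\<close>, one branching step multiplies \<open>\<Sum>x\<in>\<zeta>. exp (\<theta> x)\<close> by at most
  \<open>exp b\<^sub>1 cosh \<theta>\<close>, so Jensen's inequality gives \<open>b + \<theta> m \<le> b\<^sub>1 + ln (cosh \<theta>)\<close> for the speed \<open>m\<close> of
  a configuration of rate \<open>b\<close>. As \<open>\<beta>\<close> is the Legendre transform of \<open>ln cosh\<close>, this says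
  \<open>\<beta> m \<le> b\<^sub>1 - b\<close>. At \<open>b = b\<^sub>0\<close> every particle has the minimal number of children, and the
  configuration is symmetric.

  \<^emph>\<open>Lower bound.\<close> Let \<open>\<beta> x \<le> b\<^sub>1 - b\<close>. The full \<open>exp b\<^sub>1\<close>-ary tree of large depth \<open>L\<close> has at least
  \<open>r \<approx> exp (b L)\<close> particles at a position \<open>s \<ge> x L\<close>. Keep exactly \<open>r\<close> of them, let all others
  reproduce minimally for ever, and repeat the block from the kept particles. As
  \<open>r > exp (b\<^sub>0 L)\<close>, after many blocks the kept particles outweigh those discarded long ago.
\<close>

subsection \<open>Attainable configurations\<close>

lemma finite_atom_indices [simp]: "finite (atom_indices \<zeta>)"
proof -
  have "atom_indices \<zeta> \<subseteq> (SIGMA x:set_mset \<zeta>. {..<count \<zeta> x})"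
    by (auto simp: atom_indices_def)
  then show ?thesis by (rule finite_subset) auto
qed

lemma atom_indices_empty [simp]: "atom_indices {#} = {}"
  by (auto simp: atom_indices_def)

lemma atom_indices_add_mset:
  "atom_indices (add_mset x \<zeta>) = insert (x, count \<zeta> x) (atom_indices \<zeta>)"
  by (auto simp: atom_indices_def less_Suc_eq split: if_splits simp flip: count_greater_zero_iff)

lemma set_pmf_offspring_law:
  "set_pmf (offspring_law R \<zeta>) =
     (\<lambda>\<xi>. \<Sum>j\<in>atom_indices \<zeta>. image_mset (\<lambda>y. y + fst j) (\<xi> j)) `
       PiE_dflt (atom_indices \<zeta>) {#} (\<lambda>_. set_pmf R)"
  by (simp add: offspring_law_def set_Pi_pmf o_def)

lemma set_pmf_offspring_law_empty: "set_pmf (offspring_law R {#}) = {{#}}"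
  by (auto simp: set_pmf_offspring_law PiE_dflt_def)

text \<open>Peels off one atom, so that facts about the support of the product law follow by
  induction on the multiset instead of on functions over \<open>atom_indices\<close>.\<close>

lemma set_pmf_offspring_law_add_mset:
  "set_pmf (offspring_law R (add_mset x \<zeta>)) =
     {image_mset (\<lambda>y. y + x) \<xi> + \<zeta>' |\<xi> \<zeta>'. \<xi> \<in> set_pmf R \<and> \<zeta>' \<in> set_pmf (offspring_law R \<zeta>)}"
proof -
  let ?i = "(x, count \<zeta> x)" and ?I = "atom_indices \<zeta>"
  let ?f = "\<lambda>I \<xi>. \<Sum>j\<in>I. image_mset (\<lambda>y. y + fst j) (\<xi> j) :: real multiset"
  have ni: "?i \<notin> ?I" by (auto simp: atom_indices_def)
  have *: "?f (insert ?i ?I) \<xi> = image_mset (\<lambda>y. y + x) (\<xi> ?i) + ?f ?I \<xi>" for \<xi>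
    using ni by simp
  have upd: "?f ?I (\<xi>(?i := \<eta>)) = ?f ?I \<xi>" for \<xi> \<eta>
    using ni by (intro sum.cong) auto
  show ?thesis
  proof (intro equalityI subsetI)
    fix \<eta> assume "\<eta> \<in> set_pmf (offspring_law R (add_mset x \<zeta>))"
    then obtain \<xi> where \<xi>: "\<xi> \<in> PiE_dflt (insert ?i ?I) {#} (\<lambda>_. set_pmf R)"
      and \<eta>: "\<eta> = image_mset (\<lambda>y. y + x) (\<xi> ?i) + ?f ?I \<xi>"
      unfolding set_pmf_offspring_law atom_indices_add_mset * by auto
    \<comment> \<open>Members of \<open>PiE_dflt\<close> take the default value off the index set,
      so the value at \<open>?i\<close> has to be erased; by \<open>upd\<close> this leaves the sum
      over \<open>?I\<close> unchanged.\<close>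
    have "\<xi>(?i := {#}) \<in> PiE_dflt ?I {#} (\<lambda>_. set_pmf R)" "\<xi> ?i \<in> set_pmf R"
      using \<xi> ni by (auto simp: PiE_dflt_def)
    moreover from this(1) have "?f ?I \<xi> \<in> set_pmf (offspring_law R \<zeta>)"
      unfolding set_pmf_offspring_law upd[of \<xi> "{#}", symmetric] by (rule imageI)
    ultimately show "\<eta> \<in> {image_mset (\<lambda>y. y + x) \<xi> + \<zeta>' |\<xi> \<zeta>'.
        \<xi> \<in> set_pmf R \<and> \<zeta>' \<in> set_pmf (offspring_law R \<zeta>)}"
      unfolding \<eta> by blast
  next
    fix \<eta> assume "\<eta> \<in> {image_mset (\<lambda>y. y + x) \<xi> + \<zeta>' |\<xi> \<zeta>'.
        \<xi> \<in> set_pmf R \<and> \<zeta>' \<in> set_pmf (offspring_law R \<zeta>)}"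
    then obtain \<rho> \<xi> where \<rho>: "\<rho> \<in> set_pmf R" and \<xi>: "\<xi> \<in> PiE_dflt ?I {#} (\<lambda>_. set_pmf R)"
      and \<eta>: "\<eta> = image_mset (\<lambda>y. y + x) \<rho> + ?f ?I \<xi>"
      unfolding set_pmf_offspring_law by auto
    have "\<xi>(?i := \<rho>) \<in> PiE_dflt (insert ?i ?I) {#} (\<lambda>_. set_pmf R)"
      using \<xi> \<rho> by (auto simp: PiE_dflt_def)
    then have "?f (insert ?i ?I) (\<xi>(?i := \<rho>)) \<in> set_pmf (offspring_law R (add_mset x \<zeta>))"
      unfolding set_pmf_offspring_law atom_indices_add_mset by (rule imageI)
    then show "\<eta> \<in> set_pmf (offspring_law R (add_mset x \<zeta>))"
      unfolding * \<eta> upd by simp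
  qed
qed

lemma set_pmf_offspring_law_single:
  "set_pmf (offspring_law R {#0#}) = set_pmf R"
  by (simp add: set_pmf_offspring_law_add_mset set_pmf_offspring_law_empty)

text \<open>Serves measurability: equality is expressed by finitely many evaluations at Borel sets,
  the maps that \<open>random_point_measure\<close> controls. The mass off the support of
  \<open>\<zeta>\<close> is tested to exclude additional atoms.\<close>

lemma eq_iff_emeasure_atoms_measure:
  "\<xi> = \<zeta> \<longleftrightarrow>
     (\<forall>x\<in>set_mset \<zeta>. emeasure (atoms_measure \<xi>) {x} = of_nat (count \<zeta> x)) \<and>
     emeasure (atoms_measure \<xi>) (- set_mset \<zeta>) = 0"
proof -
  have 1: "emeasure (atoms_measure \<xi>) {x} = of_nat (count \<xi> x)" for x
    by (simp add: emeasure_atoms_measure filter_eq_replicate_mset)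
  have "- set_mset \<zeta> \<in> sets borel"
    by (intro borel_open open_Compl finite_imp_closed) auto
  then have 2: "emeasure (atoms_measure \<xi>) (- set_mset \<zeta>) =
      of_nat (size (filter_mset (\<lambda>x. x \<in> - set_mset \<zeta>) \<xi>))"
    by (rule emeasure_atoms_measure)
  show ?thesis
    unfolding 1 2 by (auto simp: multiset_eq_iff; metis count_eq_zero_iff)
qed

lemma random_point_measure_eq_sets:
  assumes "random_point_measure M X"
  shows "{\<omega> \<in> space M. X \<omega> = \<zeta>} \<in> sets M"
proof -
  have [measurable]: "(\<lambda>\<omega>. emeasure (atoms_measure (X \<omega>)) A) \<in> borel_measurable M"
    if "A \<in> sets borel" for A
    using assms that by (auto simp: random_point_measure_def)
  have [measurable]: "- set_mset \<zeta> \<in> sets borel"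
    by (intro borel_open open_Compl finite_imp_closed) auto
  show ?thesis
    unfolding eq_iff_emeasure_atoms_measure by measurable
qed

context prob_space
begin

text \<open>The hypothesis \<open>eq\<close> is a conditional law multiplied out, so it makes sense
  for null \<open>Q\<close> as well. Summing it over the countable support of \<open>D\<close>
  exhausts the mass of \<open>Q\<close>.\<close>

lemma AE_in_set_pmf:
  fixes D :: "'b pmf"
  assumes Q [measurable]: "Measurable.pred M Q"
    and X [measurable]: "\<And>\<zeta>. Measurable.pred M (\<lambda>\<omega>. X \<omega> = \<zeta>)"
    and eq: "\<And>\<zeta>. \<P>(\<omega> in M. X \<omega> = \<zeta> \<and> Q \<omega>) = \<P>(\<omega> in M. Q \<omega>) * pmf D \<zeta>"
  shows "AE \<omega> in M. Q \<omega> \<longrightarrow> X \<omega> \<in> set_pmf D"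
proof -
  let ?A = "\<lambda>\<zeta>. {\<omega> \<in> space M. X \<omega> = \<zeta> \<and> Q \<omega>}"
  let ?B = "\<Union>\<zeta>\<in>set_pmf D. ?A \<zeta>" and ?Q = "{\<omega> \<in> space M. Q \<omega>}"
  have meas: "?A \<zeta> \<in> sets M" for \<zeta> by measurable
  have B: "?B \<in> sets M"
    by (intro sets.countable_UN'' meas) auto
  have Q': "?Q \<in> sets M" by measurable
  have "emeasure M ?B = (\<integral>\<^sup>+\<zeta>. emeasure M (?A \<zeta>) \<partial>count_space (set_pmf D))"
    using meas by (intro emeasure_UN_countable) (auto simp: disjoint_family_on_def)
  also have "\<dots> = (\<integral>\<^sup>+\<zeta>. emeasure M ?Q * ennreal (pmf D \<zeta>) \<partial>count_space (set_pmf D))"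
    by (intro nn_integral_cong) (simp add: emeasure_eq_measure eq ennreal_mult)
  also have "\<dots> = emeasure M ?Q * (\<integral>\<^sup>+\<zeta>. ennreal (pmf D \<zeta>) \<partial>count_space (set_pmf D))"
    by (intro nn_integral_cmult) auto
  also have "\<dots> = emeasure M ?Q"
    by (simp add: nn_integral_pmf emeasure_pmf)
  finally have "emeasure M (?Q - ?B) = 0"
    using B Q' by (subst emeasure_Diff) auto
  then show ?thesis
    using B Q' by (intro AE_I[where N = "?Q - ?B"]) auto
qed

end

section \<open>Attainability as step-by-step reachability\<close>

locale brw =
  fixes M :: "'w measure" and R :: "real multiset pmf" and Z :: "nat \<Rightarrow> 'w \<Rightarrow> real multiset"
  assumes brw: "branching_random_walk M R Z"
begin

sublocale prob_space M
  using brw by (simp add: branching_random_walk_def)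

lemma Z_sets [measurable]: "Measurable.pred M (\<lambda>\<omega>. Z n \<omega> = \<zeta>)"
  using brw random_point_measure_eq_sets[of M "Z n" \<zeta>]
  by (simp add: branching_random_walk_def pred_def)

text \<open>Counterpart of \<open>attainable\<close> that speaks only of single steps of positive
  probability. The relational power yields an explicit path to each reachable configuration.\<close>

definition reachable :: "nat \<Rightarrow> real multiset set" where
  "reachable n = {\<zeta>. ((\<lambda>\<xi> \<eta>. \<eta> \<in> set_pmf (offspring_law R \<xi>)) ^^ n) {#0#} \<zeta>}"

lemma reachable_0 [simp]: "reachable 0 = {{#0#}}"
  by (auto simp: reachable_def)

lemma reachable_Suc:
  "reachable (Suc n) = (\<Union>\<xi>\<in>reachable n. set_pmf (offspring_law R \<xi>))"
  by (auto simp: reachable_def)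

lemma countable_reachable: "countable (reachable n)"
proof (induction n)
  case (Suc n)
  then show ?case unfolding reachable_Suc by (intro countable_UN) auto
qed auto

lemma prob_step:
  assumes "n \<ge> 2" "\<P>(\<omega> in M. \<forall>k<n. Z k \<omega> = h k) > 0"
  shows "\<P>(\<omega> in M. Z n \<omega> = \<zeta> \<and> (\<forall>k<n. Z k \<omega> = h k)) =
    \<P>(\<omega> in M. \<forall>k<n. Z k \<omega> = h k) * pmf (offspring_law R (h (n - 1))) \<zeta>"
proof -
  have "\<P>(\<omega> in M. Z n \<omega> = \<zeta> \<bar> \<forall>k<n. Z k \<omega> = h k) = pmf (offspring_law R (h (n - 1))) \<zeta>"
    using brw assms unfolding branching_random_walk_def by blast
  then show ?thesis
    using assms(2) by (simp add: cond_prob_def field_simps)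
qed

lemma prob_first: "\<P>(\<omega> in M. Z 1 \<omega> = \<zeta>) = pmf R \<zeta>"
  using brw unfolding branching_random_walk_def by blast

lemma AE_zero: "AE \<omega> in M. Z 0 \<omega> = {#0#}"
  using brw unfolding branching_random_walk_def by blast

text \<open>Conditional laws are prescribed only given a whole history of positive probability, so
  the induction is strong and ranges over all histories with reachable entries. There are countably
  many of these, so the exceptional null sets can be collected.\<close>

lemma AE_reachable: "AE \<omega> in M. Z n \<omega> \<in> reachable n"
proof (induction n rule: less_induct)
  case (less n)
  consider "n = 0" | "n = 1" | "n \<ge> 2" by linarith
  then show ?case
  proof cases
    case 1
    then show ?thesis using AE_zero by simp
  next
    case 2
    have "AE \<omega> in M. True \<longrightarrow> Z 1 \<omega> \<in> set_pmf R"
      by (intro AE_in_set_pmf) (auto simp: prob_first prob_space simp del: One_nat_def)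
    then show ?thesis using 2 by (simp add: set_pmf_offspring_law_single reachable_Suc)
  next
    case 3
    let ?H = "PiE {..<n} reachable"
    have cnt: "countable ?H"
      by (intro countable_PiE countable_reachable) auto
    have "AE \<omega> in M. (\<forall>k<n. Z k \<omega> = h k) \<longrightarrow> Z n \<omega> \<in> reachable n" if "h \<in> ?H" for h
    proof (cases "\<P>(\<omega> in M. \<forall>k<n. Z k \<omega> = h k) > 0")
      case True
      have "AE \<omega> in M. (\<forall>k<n. Z k \<omega> = h k) \<longrightarrow> Z n \<omega> \<in> set_pmf (offspring_law R (h (n - 1)))"
        using prob_step[OF 3 True] by (intro AE_in_set_pmf) auto
      moreover have "h (n - 1) \<in> reachable (n - 1)"
        using that 3 by (auto simp: PiE_def Pi_def)
      then have "set_pmf (offspring_law R (h (n - 1))) \<subseteq> reachable n"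
        using 3 reachable_Suc[of "n - 1"] by (auto simp: Suc_diff_Suc)
      ultimately show ?thesis by (elim eventually_mono) auto
    next
      case False
      then have "\<P>(\<omega> in M. \<forall>k<n. Z k \<omega> = h k) = 0"
        by (simp add: zero_less_measure_iff)
      then have "AE \<omega> in M. \<not> (\<forall>k<n. Z k \<omega> = h k)"
        by (subst (asm) prob_eq_0) auto
      then show ?thesis by (elim eventually_mono) auto
    qed
    then have "AE \<omega> in M. \<forall>h\<in>?H. (\<forall>k<n. Z k \<omega> = h k) \<longrightarrow> Z n \<omega> \<in> reachable n"
      unfolding AE_ball_countable[OF cnt] by blast
    moreover have "AE \<omega> in M. \<forall>k\<in>{..<n}. Z k \<omega> \<in> reachable k"
      using less.IH by (subst AE_ball_countable) auto
    ultimately show ?thesis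
    proof eventually_elim
      case (elim \<omega>)
      \<comment> \<open>Elements of \<open>PiE\<close> are \<open>undefined\<close> off the index
        set, hence the restriction.\<close>
      have "restrict (\<lambda>k. Z k \<omega>) {..<n} \<in> ?H" using elim(2) by auto
      with elim(1) show ?case by (metis lessThan_iff restrict_apply')
    qed
  qed
qed

text \<open>Multiplies positive transition probabilities along the path; positivity of the history
  so far is what permits the next use of \<open>prob_step\<close>.\<close>

lemma prob_path_pos:
  assumes "h 0 = {#0#}" "\<And>k. k < n \<Longrightarrow> h (Suc k) \<in> set_pmf (offspring_law R (h k))"
  shows "\<P>(\<omega> in M. \<forall>k<Suc n. Z k \<omega> = h k) > 0"
  using assms
proof (induction n)
  case 0
  have "\<P>(\<omega> in M. Z 0 \<omega> = {#0#}) = 1"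
    using AE_zero by (subst prob_Collect_eq_1) auto
  then show ?case using 0 by simp
next
  case (Suc n)
  have IH: "\<P>(\<omega> in M. \<forall>k<Suc n. Z k \<omega> = h k) > 0"
    using Suc by auto
  have *: "\<P>(\<omega> in M. \<forall>k<Suc (Suc n). Z k \<omega> = h k) =
      \<P>(\<omega> in M. Z (Suc n) \<omega> = h (Suc n) \<and> (\<forall>k<Suc n. Z k \<omega> = h k))"
    by (intro arg_cong[where f = "measure M"]) (auto simp: less_Suc_eq)
  have step: "pmf (offspring_law R (h n)) (h (Suc n)) > 0"
    using Suc.prems(2)[of n] by (simp add: pmf_positive)
  show ?case
  \<comment> \<open>Conditional laws are given from time 2 on. At time 1 the history is an almost
    sure event, and the law of \<open>Z 1\<close> is used directly.\<close>
  proof (cases "n = 0")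
    case True
    have "\<P>(\<omega> in M. Z (Suc n) \<omega> = h (Suc n) \<and> (\<forall>k<Suc n. Z k \<omega> = h k)) =
        \<P>(\<omega> in M. Z 1 \<omega> = h 1)"
      using AE_zero by (intro measure_eq_AE) (auto elim!: eventually_mono simp: Suc.prems(1) True)
    also have "\<dots> > 0"
      using Suc.prems(2)[of 0] Suc.prems(1)
      unfolding prob_first by (simp add: set_pmf_offspring_law_single pmf_positive)
    finally show ?thesis unfolding * .
  next
    case False
    then show ?thesis
      unfolding * using prob_step[of "Suc n" h "h (Suc n)"] IH step by simp
  qed
qed

text \<open>An unreachable configuration is almost surely avoided, and a reachable one ends a path
  of positive probability.\<close>

lemma attainable_eq_reachable: "attainable M Z n = reachable n"
proof (intro equalityI subsetI)
  fix \<zeta> assume "\<zeta> \<in> attainable M Z n"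
  then have pos: "\<P>(\<omega> in M. Z n \<omega> = \<zeta>) > 0" by (simp add: attainable_def)
  show "\<zeta> \<in> reachable n"
  proof (rule ccontr)
    assume "\<zeta> \<notin> reachable n"
    then have "AE \<omega> in M. Z n \<omega> \<noteq> \<zeta>"
      using AE_reachable[of n] by (elim eventually_mono) auto
    then have "\<P>(\<omega> in M. Z n \<omega> = \<zeta>) = 0"
      by (subst prob_eq_0) auto
    with pos show False by simp
  qed
next
  fix \<zeta> assume "\<zeta> \<in> reachable n"
  then obtain h where h: "h 0 = {#0#}" "h n = \<zeta>"
      "\<And>k. k < n \<Longrightarrow> h (Suc k) \<in> set_pmf (offspring_law R (h k))"
    by (auto simp: reachable_def relpowp_fun_conv)
  have "0 < \<P>(\<omega> in M. \<forall>k<Suc n. Z k \<omega> = h k)"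
    using h by (intro prob_path_pos)
  also have "\<dots> \<le> \<P>(\<omega> in M. Z n \<omega> = \<zeta>)"
    using h(2) by (intro finite_measure_mono) auto
  finally show "\<zeta> \<in> attainable M Z n" by (simp add: attainable_def)
qed

end

section \<open>Mass and mean of an atomic measure\<close>

lemma total_mass_atoms_measure: "total_mass (atoms_measure \<zeta>) = size \<zeta>"
  by (simp add: total_mass_def measure_def emeasure_atoms_measure ennreal_of_nat_eq_real_of_nat)

text \<open>\<open>S\<close> may exceed the support, so it can stay fixed while the induction adds
  atoms.\<close>

lemma sum_count_times:
  fixes \<zeta> :: "real multiset"
  assumes "finite S" "set_mset \<zeta> \<subseteq> S"
  shows "(\<Sum>x\<in>S. real (count \<zeta> x) * x) = sum_mset \<zeta>"
  using assms(2)
proof (induction \<zeta>)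
  case (add a \<zeta>)
  have "(\<Sum>x\<in>S. real (count (add_mset a \<zeta>) x) * x) =
      (\<Sum>x\<in>S. real (count \<zeta> x) * x + (if x = a then x else 0))"
    by (intro sum.cong) (auto simp: algebra_simps)
  then show ?case using add assms(1) by (simp add: sum.distrib)
qed auto

lemma first_moment_normalized_atoms_measure:
  assumes "\<zeta> \<noteq> {#}"
  shows "first_moment (normalized (atoms_measure \<zeta>)) = sum_mset \<zeta> / size \<zeta>"
proof -
  have s: "size \<zeta> > 0" using assms by (simp add: nonempty_has_size)
  have e: "emeasure (atoms_measure \<zeta>) UNIV = ennreal (size \<zeta>)"
    by (simp add: emeasure_atoms_measure ennreal_of_nat_eq_real_of_nat)
  have "1 / ennreal (size \<zeta>) = ennreal (1 / size \<zeta>)"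
    using s divide_ennreal[of 1 "size \<zeta>"] by simp
  \<comment> \<open>Scaling by a constant is a constant density, which makes
    \<open>integral_density\<close> applicable.\<close>
  then have "normalized (atoms_measure \<zeta>) = density (atoms_measure \<zeta>) (\<lambda>_. ennreal (1 / size \<zeta>))"
    by (intro measure_eqI) (auto simp: normalized_def e emeasure_density nn_integral_cmult_indicator)
  then have "first_moment (normalized (atoms_measure \<zeta>)) = (\<integral>x. x \<partial>atoms_measure \<zeta>) / size \<zeta>"
    by (simp add: first_moment_def integral_density)
  also have "(\<integral>x. x \<partial>atoms_measure \<zeta>) =
      (\<integral>x. x \<partial>point_measure (set_mset \<zeta>) (\<lambda>x. ennreal (real (count \<zeta> x))))"
    by (simp add: atoms_measure_def integral_distr ennreal_of_nat_eq_real_of_nat)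
  also have "\<dots> = (\<Sum>x\<in>set_mset \<zeta>. real (count \<zeta> x) * x)"
    by (subst lebesgue_integral_point_measure_finite) auto
  also have "\<dots> = sum_mset \<zeta>"
    by (simp add: sum_count_times)
  finally show ?thesis .
qed

subsection \<open>Deterministic branching\<close>

text \<open>For \<open>K = set_pmf N\<close> this is the support of the offspring law, see
  \<open>set_pmf_offspring_law_balanced_reproduction\<close>; the inductive form permits arguments
  particle by particle.\<close>

inductive offspring :: "nat set \<Rightarrow> real multiset \<Rightarrow> real multiset \<Rightarrow> bool" for K where
  empty: "offspring K {#} {#}"
| add: "k \<in> K \<Longrightarrow> offspring K \<zeta> \<zeta>' \<Longrightarrow> offspring K (add_mset x \<zeta>)
     (replicate_mset (k div 2) (x - 1) + replicate_mset (k div 2) (x + 1) + \<zeta>')"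

lemma offspring_union:
  "offspring K \<zeta> \<zeta>' \<Longrightarrow> offspring K \<xi> \<xi>' \<Longrightarrow> offspring K (\<zeta> + \<xi>) (\<zeta>' + \<xi>')"
proof (induction rule: offspring.induct)
  case (add k \<zeta> \<zeta>' x)
  then show ?case using offspring.add[of k K "\<zeta> + \<xi>" "\<zeta>' + \<xi>'" x] by (simp add: add.assoc)
qed simp

lemma offspring_shift:
  "offspring K \<zeta> \<zeta>' \<Longrightarrow> offspring K (image_mset (\<lambda>y. y + c) \<zeta>) (image_mset (\<lambda>y. y + c) \<zeta>')"
proof (induction rule: offspring.induct)
  case (add k \<zeta> \<zeta>' x)
  then show ?case
    using offspring.add[of k K _ _ "x + c"] by (simp add: algebra_simps)
qed (simp add: offspring.empty)

lemma descendants_union: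
  "(offspring K ^^ n) \<zeta> \<zeta>' \<Longrightarrow> (offspring K ^^ n) \<xi> \<xi>' \<Longrightarrow>
     (offspring K ^^ n) (\<zeta> + \<xi>) (\<zeta>' + \<xi>')"
proof (induction n arbitrary: \<zeta>' \<xi>')
  case (Suc n)
  then show ?case by (auto elim!: relcomppE intro!: relcomppI offspring_union)
qed auto

lemma descendants_shift:
  "(offspring K ^^ n) \<zeta> \<zeta>' \<Longrightarrow>
     (offspring K ^^ n) (image_mset (\<lambda>y. y + c) \<zeta>) (image_mset (\<lambda>y. y + c) \<zeta>')"
proof (induction n arbitrary: \<zeta>')
  case (Suc n)
  then show ?case by (auto elim!: relcomppE intro!: relcomppI offspring_shift)
qed auto

lemma descendants_empty: "(offspring K ^^ n) {#} {#}"
  by (induction n) (auto intro!: relcomppI offspring.empty)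

lemma descendants_add:
  "(offspring K ^^ m) \<zeta> \<xi> \<Longrightarrow> (offspring K ^^ n) \<xi> \<eta> \<Longrightarrow> (offspring K ^^ (m + n)) \<zeta> \<eta>"
  by (auto simp: relpowp_add)

lemma sum_mset_shift:
  "sum_mset (image_mset (\<lambda>y. y + c) \<zeta>) = sum_mset \<zeta> + real (size \<zeta>) * c"
  by (induction \<zeta>) (auto simp: algebra_simps)

text \<open>All particles of \<open>\<xi>\<close> run translates of one and the same history leading
  to \<open>\<zeta>\<close>, which makes the size and the sum of the result explicit.\<close>

lemma descendants_independent_copies:
  assumes "(offspring K ^^ n) {#0#} \<zeta>"
  shows "\<exists>\<xi>'. (offspring K ^^ n) \<xi> \<xi>' \<and> size \<xi>' = size \<xi> * size \<zeta> \<and>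
     sum_mset \<xi>' = real (size \<zeta>) * sum_mset \<xi> + real (size \<xi>) * sum_mset \<zeta>"
proof (induction \<xi>)
  case empty
  then show ?case using descendants_empty by auto
next
  case (add x \<xi>)
  then obtain \<xi>' where \<xi>': "(offspring K ^^ n) \<xi> \<xi>'" "size \<xi>' = size \<xi> * size \<zeta>"
     "sum_mset \<xi>' = real (size \<zeta>) * sum_mset \<xi> + real (size \<xi>) * sum_mset \<zeta>" by blast
  have "(offspring K ^^ n) ({#x#} + \<xi>) (image_mset (\<lambda>y. y + x) \<zeta> + \<xi>')"
    using descendants_shift[OF assms, of x] \<xi>'(1) by (intro descendants_union) auto
  with \<xi>' show ?case
    by (intro exI[of _ "image_mset (\<lambda>y. y + x) \<zeta> + \<xi>'"])
      (auto simp: sum_mset_shift algebra_simps)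
qed

section \<open>Generations of the full tree\<close>

definition full_step :: "nat \<Rightarrow> real multiset \<Rightarrow> real multiset" where
  "full_step k \<zeta> =
     repeat_mset (k div 2) (image_mset (\<lambda>y. y - 1) \<zeta> + image_mset (\<lambda>y. y + 1) \<zeta>)"

lemma offspring_full_step: "k \<in> K \<Longrightarrow> offspring K \<zeta> (full_step k \<zeta>)"
proof (induction \<zeta>)
  case (add x \<zeta>)
  have "full_step k (add_mset x \<zeta>) =
      replicate_mset (k div 2) (x - 1) + replicate_mset (k div 2) (x + 1) + full_step k \<zeta>"
    by (simp add: full_step_def)
  with add show ?case by (simp add: offspring.add)
qed (simp add: full_step_def offspring.empty)

lemma descendants_full_step: "k \<in> K \<Longrightarrow> (offspring K ^^ n) \<zeta> ((full_step k ^^ n) \<zeta>)"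
  by (induction n) (auto intro!: relcomppI offspring_full_step)

lemma size_full_step: "even k \<Longrightarrow> size (full_step k \<zeta>) = k * size \<zeta>"
  by (auto simp: full_step_def)

lemma size_full_steps: "even k \<Longrightarrow> size ((full_step k ^^ n) \<zeta>) = k ^ n * size \<zeta>"
  by (induction n) (auto simp: size_full_step)

lemma sum_mset_repeat_mset:
  "sum_mset (repeat_mset m \<zeta>) = real m * sum_mset (\<zeta> :: real multiset)"
  by (induction m) (auto simp: algebra_simps)

lemma sum_mset_full_step:
  assumes "even k"
  shows "sum_mset (full_step k \<zeta>) = real k * sum_mset \<zeta>"
proof -
  have "sum_mset (full_step k \<zeta>) = real (k div 2) * (2 * sum_mset \<zeta>)"
    using sum_mset_shift[of 1 \<zeta>] sum_mset_shift[of "-1" \<zeta>]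
    by (simp add: full_step_def sum_mset_repeat_mset flip: distrib_left)
  then show ?thesis using assms by (simp add: real_of_nat_div)
qed

lemma sum_mset_full_steps: "even k \<Longrightarrow> sum_mset ((full_step k ^^ n) {#0#}) = 0"
  by (induction n) (auto simp: sum_mset_full_step)

lemma set_mset_repeat_mset_subset: "set_mset (repeat_mset m \<zeta>) \<subseteq> set_mset \<zeta>"
  by (auto simp flip: count_greater_zero_iff)

lemma full_steps_ge: "y \<in># (full_step k ^^ n) {#0#} \<Longrightarrow> - real n \<le> y"
proof (induction n arbitrary: y)
  case (Suc n)
  then have "y \<in># full_step k ((full_step k ^^ n) {#0#})" by simp
  then obtain x where "x \<in># (full_step k ^^ n) {#0#}" "y = x - 1 \<or> y = x + 1"
    unfolding full_step_def by (auto dest!: subsetD[OF set_mset_repeat_mset_subset])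
  with Suc.IH[of x] show ?case by auto
qed auto

lemma count_shift: "count (image_mset (\<lambda>y. y + c) \<zeta>) y = count \<zeta> (y - c :: real)"
  by (induction \<zeta>) (auto simp: algebra_simps)

lemma count_full_step:
  "count (full_step k \<zeta>) y = (k div 2) * (count \<zeta> (y + 1) + count \<zeta> (y - 1))"
  using count_shift[of 1 \<zeta> y] count_shift[of "-1" \<zeta> y] by (simp add: full_step_def algebra_simps)

text \<open>Pascal's rule: \<open>j\<close> of the \<open>n\<close> steps go up, and each step
  offers \<open>k div 2\<close> children in either direction.\<close>

lemma count_full_steps:
  "(k div 2) ^ n * (n choose j) \<le> count ((full_step k ^^ n) {#0#}) (2 * real j - real n)"
proof (induction n arbitrary: j)
  case 0
  then show ?case by (cases j) auto
next
  case (Suc n)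
  let ?\<zeta> = "(full_step k ^^ n) {#0#}"
  have c: "count ((full_step k ^^ Suc n) {#0#}) (2 * real j - real (Suc n)) =
      (k div 2) * (count ?\<zeta> (2 * real j - real n) + count ?\<zeta> (2 * real j - real n - 2))"
    by (simp add: count_full_step algebra_simps)
  have "(k div 2) ^ n * (Suc n choose j) \<le>
      count ?\<zeta> (2 * real j - real n) + count ?\<zeta> (2 * real j - real n - 2)"
  proof (cases j)
    case 0
    then show ?thesis using Suc.IH[of j] by simp
  next
    case (Suc i)
    have "2 * real j - real n - 2 = 2 * real i - real n" using Suc by simp
    then show ?thesis
      using Suc.IH[of j] Suc.IH[of i] unfolding Suc by (simp add: algebra_simps)
  qed
  then show ?case
    unfolding c by (simp add: mult.assoc)
qed

text \<open>Children lie symmetrically about their parent. Minimal total size forces the minimal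
  number of children for every single particle, and then the sum scales by that same factor.\<close>

lemma offspring_size_sum:
  assumes "offspring K \<zeta> \<zeta>'" "\<And>k. k \<in> K \<Longrightarrow> even k" "\<And>k. k \<in> K \<Longrightarrow> k\<^sub>0 \<le> k"
  shows "k\<^sub>0 * size \<zeta> \<le> size \<zeta>' \<and>
    (size \<zeta>' = k\<^sub>0 * size \<zeta> \<longrightarrow> sum_mset \<zeta>' = real k\<^sub>0 * sum_mset \<zeta>)"
  using assms(1)
proof (induction rule: offspring.induct)
  case (add k \<zeta> \<zeta>' x)
  from add.hyps assms have k: "k = 2 * (k div 2)" "k\<^sub>0 \<le> k" by auto
  let ?\<eta> = "replicate_mset (k div 2) (x - 1) + replicate_mset (k div 2) (x + 1) + \<zeta>'"
  have s: "size ?\<eta> = k + size \<zeta>'" using k(1) by simp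
  have "real k = 2 * real (k div 2)" using k(1) by linarith
  then have m: "sum_mset ?\<eta> = real k * x + sum_mset \<zeta>'" by (simp add: algebra_simps)
  show ?case
  proof (intro conjI impI)
    show "k\<^sub>0 * size (add_mset x \<zeta>) \<le> size ?\<eta>"
      unfolding s using add.IH k by simp
    assume "size ?\<eta> = k\<^sub>0 * size (add_mset x \<zeta>)"
    then have "k = k\<^sub>0" "size \<zeta>' = k\<^sub>0 * size \<zeta>"
      unfolding s using add.IH k by auto
    then show "sum_mset ?\<eta> = real k\<^sub>0 * sum_mset (add_mset x \<zeta>)"
      unfolding m using add.IH by (simp add: algebra_simps)
  qed
qed auto

text \<open>Minimal size at the end forces minimal size in every generation, so the sum stays 0.
  This settles the upper bound at the minimal rate.\<close>

lemma descendants_size_sum: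
  assumes "(offspring K ^^ n) {#0#} \<zeta>" "\<And>k. k \<in> K \<Longrightarrow> even k" "\<And>k. k \<in> K \<Longrightarrow> k\<^sub>0 \<le> k" "0 < k\<^sub>0"
  shows "k\<^sub>0 ^ n \<le> size \<zeta> \<and> (size \<zeta> = k\<^sub>0 ^ n \<longrightarrow> sum_mset \<zeta> = 0)"
  using assms(1)
proof (induction n arbitrary: \<zeta>)
  case (Suc n)
  then obtain \<xi> where \<xi>: "(offspring K ^^ n) {#0#} \<xi>" "offspring K \<xi> \<zeta>" by auto
  have IH: "k\<^sub>0 ^ n \<le> size \<xi>" "size \<xi> = k\<^sub>0 ^ n \<longrightarrow> sum_mset \<xi> = 0"
    using Suc.IH[OF \<xi>(1)] by auto
  have step: "k\<^sub>0 * size \<xi> \<le> size \<zeta>" "size \<zeta> = k\<^sub>0 * size \<xi> \<longrightarrow> sum_mset \<zeta> = real k\<^sub>0 * sum_mset \<xi>"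
    using offspring_size_sum[OF \<xi>(2) assms(2,3)] by auto
  have le: "k\<^sub>0 * k\<^sub>0 ^ n \<le> k\<^sub>0 * size \<xi>" using IH(1) by (rule mult_le_mono2)
  show ?case
  proof (intro conjI impI)
    show "k\<^sub>0 ^ Suc n \<le> size \<zeta>" using order.trans[OF le step(1)] by simp
    assume "size \<zeta> = k\<^sub>0 ^ Suc n"
    then have "size \<zeta> = k\<^sub>0 * size \<xi>" "k\<^sub>0 * size \<xi> = k\<^sub>0 * k\<^sub>0 ^ n" using le step(1) by auto
    then show "sum_mset \<zeta> = 0" using IH(2) step(2) assms(4) by simp
  qed
qed auto

text \<open>The \<open>k\<close> children of a particle at \<open>x\<close> contribute exactly
  \<open>k * cosh \<theta> * exp (\<theta> * x)\<close>, as \<open>cosh\<close> is the Laplace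
  transform of a fair sign.\<close>

lemma offspring_exp_sum:
  assumes "offspring K \<zeta> \<zeta>'" "\<And>k. k \<in> K \<Longrightarrow> even k \<and> k \<le> k\<^sub>1"
  shows "(\<Sum>x\<in>#\<zeta>'. exp (\<theta> * x)) \<le> real k\<^sub>1 * cosh \<theta> * (\<Sum>x\<in>#\<zeta>. exp (\<theta> * x))"
  using assms(1)
proof (induction rule: offspring.induct)
  case (add k \<zeta> \<zeta>' x)
  let ?\<eta> = "replicate_mset (k div 2) (x - 1) + replicate_mset (k div 2) (x + 1) + \<zeta>'"
  have k: "real k = 2 * real (k div 2)" "real k \<le> real k\<^sub>1"
    using assms(2)[OF add.hyps(1)] by (auto simp: real_of_nat_div)
  have "(\<Sum>x\<in>#?\<eta>. exp (\<theta> * x)) =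
      real (k div 2) * (exp (\<theta> * (x - 1)) + exp (\<theta> * (x + 1))) + (\<Sum>x\<in>#\<zeta>'. exp (\<theta> * x))"
    by (simp add: algebra_simps)
  also have "exp (\<theta> * (x - 1)) + exp (\<theta> * (x + 1)) = 2 * cosh \<theta> * exp (\<theta> * x)"
    by (simp add: cosh_def field_simps flip: exp_add)
  also have "real (k div 2) * \<dots> = real k * cosh \<theta> * exp (\<theta> * x)"
    using k(1) by simp
  also have "\<dots> \<le> real k\<^sub>1 * cosh \<theta> * exp (\<theta> * x)"
    using k(2) by (intro mult_right_mono) auto
  finally show ?case using add.IH by (simp add: algebra_simps)
qed auto

lemma descendants_exp_sum:
  assumes "(offspring K ^^ n) {#0#} \<zeta>" "\<And>k. k \<in> K \<Longrightarrow> even k \<and> k \<le> k\<^sub>1"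
  shows "(\<Sum>x\<in>#\<zeta>. exp (\<theta> * x)) \<le> (real k\<^sub>1 * cosh \<theta>) ^ n"
  using assms(1)
proof (induction n arbitrary: \<zeta>)
  case (Suc n)
  then obtain \<xi> where \<xi>: "(offspring K ^^ n) {#0#} \<xi>" "offspring K \<xi> \<zeta>" by auto
  have "(\<Sum>x\<in>#\<zeta>. exp (\<theta> * x)) \<le> real k\<^sub>1 * cosh \<theta> * (\<Sum>x\<in>#\<xi>. exp (\<theta> * x))"
    by (rule offspring_exp_sum[OF \<xi>(2) assms(2)])
  also have "\<dots> \<le> real k\<^sub>1 * cosh \<theta> * (real k\<^sub>1 * cosh \<theta>) ^ n"
    by (intro mult_left_mono Suc.IH \<xi>) auto
  finally show ?case by simp
qed auto

text \<open>The tangent line of \<open>exp\<close> at \<open>\<theta> * c\<close>, summed over the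
  atoms. When \<open>c\<close> is the mean, the linear term vanishes and this is Jensen's
  inequality.\<close>

lemma sum_mset_exp_ge:
  "exp (\<theta> * c) * (real (size \<zeta>) + \<theta> * (sum_mset \<zeta> - c * real (size \<zeta>))) \<le> (\<Sum>x\<in>#\<zeta>. exp (\<theta> * x))"
proof (induction \<zeta>)
  case (add x \<zeta>)
  have "exp (\<theta> * c) * (1 + \<theta> * (x - c)) \<le> exp (\<theta> * c) * exp (\<theta> * (x - c))"
    by (intro mult_left_mono exp_ge_add_one_self) auto
  also have "\<dots> = exp (\<theta> * x)" by (simp add: algebra_simps flip: exp_add)
  finally show ?case using add by (simp add: algebra_simps)
qed auto

lemma descendants_le:
  assumes "(offspring K ^^ n) {#0#} \<zeta>" "x \<in># \<zeta>"
  shows "x \<le> real n"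
  using assms
proof (induction n arbitrary: \<zeta> x)
  case (Suc n)
  then obtain \<xi> where \<xi>: "(offspring K ^^ n) {#0#} \<xi>" "offspring K \<xi> \<zeta>" by auto
  from \<xi>(2) Suc.prems(2) have "\<exists>y\<in>#\<xi>. x \<le> y + 1"
    by (induction rule: offspring.induct) (auto split: if_splits)
  with Suc.IH[OF \<xi>(1)] show ?case by fastforce
qed auto

lemma sum_mset_le_size:
  "(\<And>x. x \<in># \<zeta> \<Longrightarrow> x \<le> c) \<Longrightarrow> sum_mset \<zeta> \<le> real (size \<zeta>) * (c :: real)"
  by (induction \<zeta>) (auto simp: algebra_simps intro: add_mono)

lemma sum_mset_ge_size:
  "(\<And>x. x \<in># \<zeta> \<Longrightarrow> c \<le> x) \<Longrightarrow> real (size \<zeta>) * (c :: real) \<le> sum_mset \<zeta>"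
  by (induction \<zeta>) (auto simp: algebra_simps intro: add_mono)

section \<open>From the support of the offspring law to deterministic branching\<close>

lemma set_pmf_balanced_reproduction:
  "set_pmf (balanced_reproduction N) =
     (\<lambda>k. replicate_mset (k div 2) (-1) + replicate_mset (k div 2) 1) ` set_pmf N"
  by (simp add: balanced_reproduction_def)

lemma set_pmf_offspring_law_balanced_reproduction:
  "\<zeta>' \<in> set_pmf (offspring_law (balanced_reproduction N) \<zeta>) \<longleftrightarrow> offspring (set_pmf N) \<zeta> \<zeta>'"
proof
  assume "offspring (set_pmf N) \<zeta> \<zeta>'"
  then show "\<zeta>' \<in> set_pmf (offspring_law (balanced_reproduction N) \<zeta>)"
  proof (induction rule: offspring.induct)
    case empty
    then show ?case by (simp add: set_pmf_offspring_law_empty)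
  next
    case (add k \<zeta> \<zeta>' x)
    have eq: "replicate_mset (k div 2) (x - 1) + replicate_mset (k div 2) (x + 1) =
        image_mset (\<lambda>y. y + x) (replicate_mset (k div 2) (-1) + replicate_mset (k div 2) 1)"
      by (simp add: add.commute)
    show ?case
      unfolding eq set_pmf_offspring_law_add_mset set_pmf_balanced_reproduction
      by (intro CollectI exI conjI, rule refl) (use add in auto)
  qed
next
  show "\<zeta>' \<in> set_pmf (offspring_law (balanced_reproduction N) \<zeta>) \<Longrightarrow> offspring (set_pmf N) \<zeta> \<zeta>'"
  proof (induction \<zeta> arbitrary: \<zeta>')
    case empty
    then show ?case by (simp add: set_pmf_offspring_law_empty offspring.empty)
  next
    case (add x \<zeta>)
    from add.prems obtain k \<eta> where k: "k \<in> set_pmf N"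
      and \<eta>: "\<eta> \<in> set_pmf (offspring_law (balanced_reproduction N) \<zeta>)"
      and eq: "\<zeta>' = image_mset (\<lambda>y. y + x) (replicate_mset (k div 2) (-1) + replicate_mset (k div 2) 1) + \<eta>"
      unfolding set_pmf_offspring_law_add_mset set_pmf_balanced_reproduction by blast
    have "\<zeta>' = replicate_mset (k div 2) (x - 1) + replicate_mset (k div 2) (x + 1) + \<eta>"
      by (simp add: eq add.commute)
    with offspring.add[OF k add.IH[OF \<eta>]] show ?case by simp
  qed
qed

lemma attainable_balanced_reproduction:
  assumes "branching_random_walk M (balanced_reproduction N) Z"
  shows "attainable M Z n = {\<zeta>. (offspring (set_pmf N) ^^ n) {#0#} \<zeta>}"
proof -
  interpret brw M "balanced_reproduction N" Z by unfold_locales fact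
  show ?thesis
    unfolding attainable_eq_reachable reachable_def set_pmf_offspring_law_balanced_reproduction
    by (rule refl)
qed

lemma set_pmf_two_points:
  assumes "pmf N x = p" "pmf N y = 1 - p" "0 < p" "p < 1" "x \<noteq> y"
  shows "set_pmf N = {x, y}"
proof -
  have "measure_pmf.prob N {x, y} = 1"
    using assms by (simp add: measure_measure_pmf_finite)
  then have "set_pmf N \<subseteq> {x, y}"
    by (subst (asm) measure_pmf.prob_eq_1) (auto simp: AE_measure_pmf_iff)
  moreover have "{x, y} \<subseteq> set_pmf N"
    using assms by (auto simp: set_pmf_iff)
  ultimately show ?thesis by blast
qed

subsection \<open>The rate function\<close>

text \<open>Only \<open>t = 0\<close> is delicate: the value there is 0, which is also the limit
  from the right.\<close>

lemma continuous_on_times_ln: "continuous_on {0..} (\<lambda>t::real. t * ln t)"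
proof -
  have "continuous (at t within {0..}) (\<lambda>t::real. t * ln t)" if "t \<ge> 0" for t
  proof (cases "t = 0")
    case True
    have "((\<lambda>t::real. t * ln t) \<longlongrightarrow> 0) (at_right 0)" by real_asymp
    then show ?thesis
      using True by (simp add: continuous_within at_within_Ici_at_right)
  next
    case False
    then show ?thesis by (intro continuous_intros) auto
  qed
  then show ?thesis by (simp add: continuous_on_eq_continuous_within)
qed

lemma continuous_on_\<beta>: "continuous_on {0..1} \<beta>"
  unfolding \<beta>_def
  by (intro continuous_intros continuous_on_compose2[OF continuous_on_times_ln]) auto

lemma \<beta>_0 [simp]: "\<beta> 0 = 0" and \<beta>_1 [simp]: "\<beta> 1 = ln 2"
  by (auto simp: \<beta>_def)

text \<open>The derivative is artanh, positive on the open unit interval but infinite at 1; the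
  endpoints are therefore reached by continuity.\<close>

lemma \<beta>_strict_mono:
  assumes "0 \<le> x" "x < y" "y \<le> 1"
  shows "\<beta> x < \<beta> y"
proof (rule DERIV_pos_imp_increasing_open[OF assms(2)])
  fix u assume u: "x < u" "u < y"
  have "(\<beta> has_real_derivative (ln (1 + u) - ln (1 - u)) / 2) (at u)"
    unfolding \<beta>_def using u assms by (auto intro!: derivative_eq_intros)
  moreover have "ln (1 - u) < ln (1 + u)" using u assms by (intro ln_less_cancel_iff[THEN iffD2]) auto
  ultimately show "\<exists>d. DERIV \<beta> u :> d \<and> d > 0" by (intro exI conjI) auto
next
  show "continuous_on {x..y} \<beta>"
    using assms by (intro continuous_on_subset[OF continuous_on_\<beta>]) auto
qed

lemma \<beta>_bij_betw: "bij_betw \<beta> {0..1} {0..ln 2}"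
proof (rule bij_betw_imageI)
  show "inj_on \<beta> {0..1}"
    by (rule linorder_inj_onI) (use \<beta>_strict_mono in \<open>force+\<close>)
  show "\<beta> ` {0..1} = {0..ln 2}"
  proof (intro equalityI subsetI)
    fix z assume "z \<in> \<beta> ` {0..1}"
    then obtain x where x: "0 \<le> x" "x \<le> 1" "z = \<beta> x" by auto
    then have "\<beta> 0 \<le> \<beta> x" "\<beta> x \<le> \<beta> 1"
      using \<beta>_strict_mono[of 0 x] \<beta>_strict_mono[of x 1] by (metis less_eq_real_def order.refl)+
    with x show "z \<in> {0..ln 2}" by simp
  next
    fix z assume "z \<in> {0..ln (2::real)}"
    then have "\<exists>x\<ge>0. x \<le> 1 \<and> \<beta> x = z"
      by (intro IVT' continuous_on_\<beta>) auto
    then show "z \<in> \<beta> ` {0..1}" by auto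
  qed
qed

lemma \<gamma>_props:
  assumes "b\<^sub>0 < b" "b \<le> b\<^sub>1"
  shows "0 \<le> \<gamma> b\<^sub>0 b\<^sub>1 b" "\<gamma> b\<^sub>0 b\<^sub>1 b \<le> 1" "\<beta> (\<gamma> b\<^sub>0 b\<^sub>1 b) = min (b\<^sub>1 - b) (ln 2)"
proof -
  have *: "min (b\<^sub>1 - b) (ln 2) \<in> \<beta> ` {0..1}"
    using assms bij_betw_imp_surj_on[OF \<beta>_bij_betw] by auto
  have inj: "inj_on \<beta> {0..1}" using \<beta>_bij_betw by (rule bij_betw_imp_inj_on)
  have "\<gamma> b\<^sub>0 b\<^sub>1 b \<in> {0..1}"
    using assms the_inv_into_into[OF inj * order.refl] by (simp add: \<gamma>_def)
  then show "0 \<le> \<gamma> b\<^sub>0 b\<^sub>1 b" "\<gamma> b\<^sub>0 b\<^sub>1 b \<le> 1" by auto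
  show "\<beta> (\<gamma> b\<^sub>0 b\<^sub>1 b) = min (b\<^sub>1 - b) (ln 2)"
    using assms f_the_inv_into_f[OF inj *] by (simp add: \<gamma>_def)
qed

text \<open>\<open>\<theta>\<close> is artanh of \<open>g\<close>, the maximiser of
  \<open>\<theta> * g - ln (cosh \<theta>)\<close>; it is finite because
  \<open>g < 1\<close>.\<close>

lemma \<beta>_legendre:
  assumes "0 \<le> g" "g < 1"
  defines "\<theta> \<equiv> (ln (1 + g) - ln (1 - g)) / 2"
  shows "\<beta> g = \<theta> * g - ln (cosh \<theta>)"
proof -
  \<comment> \<open>This is the inverse square root of \<open>1 - g^2\<close>; then
    \<open>exp \<theta>\<close> and \<open>exp (- \<theta>)\<close> are \<open>1 + g\<close> and
    \<open>1 - g\<close> times \<open>?u\<close>, with mean \<open>?u\<close>.\<close>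
  let ?u = "exp (- (ln (1 + g) + ln (1 - g)) / 2)"
  have "exp \<theta> = exp (ln (1 + g)) * ?u"
    unfolding \<theta>_def by (simp add: field_simps flip: exp_add)
  moreover have "exp (- \<theta>) = exp (ln (1 - g)) * ?u"
    unfolding \<theta>_def by (simp add: field_simps flip: exp_add)
  ultimately have "cosh \<theta> = ?u"
    using assms by (simp add: cosh_def algebra_simps)
  then have "ln (cosh \<theta>) = - (ln (1 + g) + ln (1 - g)) / 2" by simp
  then show ?thesis
    by (simp add: \<beta>_def \<theta>_def field_simps)
qed

text \<open>If \<open>m\<close> exceeded \<open>g\<close>, testing \<open>le\<close> with the slope
  dual to a point strictly between them would contradict strict monotonicity of
  \<open>\<beta>\<close>.\<close>

lemma le_if_legendre_le:
  assumes g: "0 \<le> g" "g \<le> 1" "\<beta> g = min c (ln 2)" and "m \<le> 1"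
    and le: "\<And>\<theta>. \<theta> \<ge> 0 \<Longrightarrow> \<theta> * m \<le> c + ln (cosh \<theta>)"
  shows "m \<le> g"
proof (rule ccontr)
  assume "\<not> m \<le> g"
  then have "g < m" by simp
  \<comment> \<open>The midpoint stays below 1 even if \<open>m = 1\<close>, so
    \<open>\<beta>_legendre\<close> applies to it.\<close>
  define h where "h = (g + m) / 2"
  have h: "g < h" "h < m" "h < 1" "0 < h"
    using \<open>g < m\<close> g assms(4) by (auto simp: h_def)
  have "\<beta> g < ln 2" using \<beta>_strict_mono[of g 1] g h by auto
  \<comment> \<open>Since \<open>g < 1\<close>, the truncation at \<open>ln 2\<close> is not
    active.\<close>
  then have c: "c = \<beta> g" using g(3) by auto
  define \<theta> where "\<theta> = (ln (1 + h) - ln (1 - h)) / 2"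
  have "\<theta> > 0" using h by (simp add: \<theta>_def)
  have "\<theta> * m \<le> \<beta> g + ln (cosh \<theta>)" using le[of \<theta>] \<open>\<theta> > 0\<close> c by simp
  also have "\<dots> = \<beta> g - \<beta> h + \<theta> * h"
    using \<beta>_legendre[of h] h by (simp add: \<theta>_def)
  also have "\<dots> < \<theta> * h" using \<beta>_strict_mono[of g h] g h by simp
  also have "\<dots> < \<theta> * m" using h \<open>\<theta> > 0\<close> by simp
  finally show False .
qed

section \<open>Stirling-type bounds and binomial coefficients\<close>

lemma ln_fact_ge: "real n * ln (real n) - real n \<le> ln (fact n)"
proof (cases "n = 0")
  case False
  have "real n ^ n / fact n \<le> exp (real n)"
  proof -
    \<comment> \<open>The quotient is a single term of the exponential series at
      \<open>n\<close>.\<close>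
    have s: "(\<lambda>i. real n ^ i /\<^sub>R fact i) sums exp (real n)" by (rule exp_converges)
    have "real n ^ n /\<^sub>R fact n \<le> exp (real n)"
      using sum_le_suminf[OF sums_summable[OF s], of "{n}"] sums_unique[OF s] by simp
    then show ?thesis by (simp add: field_simps)
  qed
  then have "real n ^ n \<le> exp (real n) * fact n" by (simp add: field_simps)
  then have "ln (real n ^ n) \<le> ln (exp (real n) * fact n)"
    using False by (intro ln_mono) auto
  then show ?thesis using False by (simp add: ln_mult ln_realpow)
qed auto

text \<open>At \<open>n = 0\<close> this relies on \<open>ln 0 = 0\<close>.\<close>

lemma ln_fact_le: "ln (fact n) \<le> 1 + ln (real n) + real n * ln (real n) - real n"
proof (induction n)
  case (Suc n)
  show ?case
  proof (cases "n = 0")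
    case False
    have "1 / real (Suc n) \<le> ln (real (Suc n) / real n)"
    proof -
      have "ln (real n / real (Suc n)) \<le> real n / real (Suc n) - 1"
        using False by (intro ln_le_minus_one) auto
      also have "\<dots> = - 1 / real (Suc n)" by (simp add: field_simps)
      finally show ?thesis using False by (simp add: ln_div)
    qed
    \<comment> \<open>This says that the right-hand side grows by at least \<open>ln (Suc n)\<close>
      from \<open>n\<close> to \<open>Suc n\<close>.\<close>
    then have "1 \<le> real (Suc n) * (ln (real (Suc n)) - ln (real n))"
      using False by (simp add: ln_div field_simps)
    moreover have "ln (fact (Suc n)) = ln (real (Suc n)) + ln (fact n)"
      by (simp add: ln_mult del: of_nat_Suc)
    ultimately show ?thesis using Suc by (simp add: algebra_simps)
  qed simp
qed simp

text \<open>\<open>ln 2 - \<beta> (2 * p - 1)\<close> is the binary entropy of \<open>p\<close>, so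
  the main term is \<open>n ln n - j ln j - (n - j) ln (n - j)\<close>; the remainder is the error
  of the factorial bounds.\<close>

lemma ln_binomial_ge:
  assumes "j \<le> n" "0 < n"
  shows "real n * (ln 2 - \<beta> (2 * real j / real n - 1)) - 2 - 2 * ln (real n) \<le> ln (real (n choose j))"
proof -
  let ?f = "\<lambda>i. real i * ln (real i)"
  \<comment> \<open>The case \<open>i = 0\<close> is separate because the logarithm of the product
    cannot be split there; both sides are then 0.\<close>
  have pw: "real i / real n * ln (2 * real i / real n) = (real i * ln 2 + ?f i - real i * ln (real n)) / real n"
    for i using assms by (cases "i = 0") (auto simp: ln_div ln_mult field_simps)
  have nj: "1 - (2 * real j / real n - 1) = 2 * real (n - j) / real n"
      "1 + (2 * real j / real n - 1) = 2 * real j / real n"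
    using assms by (simp_all add: of_nat_diff field_simps)
  have "\<beta> (2 * real j / real n - 1) =
      real j / real n * ln (2 * real j / real n) + real (n - j) / real n * ln (2 * real (n - j) / real n)"
    unfolding \<beta>_def nj by (simp add: add_divide_distrib mult.commute)
  also have "\<dots> = ((real j + real (n - j)) * (ln 2 - ln (real n)) + ?f j + ?f (n - j)) / real n"
    unfolding pw add_divide_distrib[symmetric] by (simp add: algebra_simps)
  also have "real j + real (n - j) = real n" using assms by simp
  finally have \<beta>: "real n * (ln 2 - \<beta> (2 * real j / real n - 1)) = ?f n - ?f j - ?f (n - j)"
    using assms by (simp add: field_simps)
  have "real (n choose j) = fact n / (fact j * fact (n - j))"
    by (rule binomial_fact[OF assms(1)])
  then have "ln (real (n choose j)) = ln (fact n) - ln (fact j) - ln (fact (n - j))"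
    by (simp add: ln_div ln_mult)
  moreover have "ln (real j) \<le> ln (real n)" "ln (real (n - j)) \<le> ln (real n)"
    using assms by (cases "j = 0"; cases "j = n"; simp)+
  ultimately show ?thesis
    unfolding \<beta>
    using ln_fact_ge[of n] ln_fact_le[of j] ln_fact_le[of "n - j"] assms by (simp add: of_nat_diff)
qed

subsection \<open>The two bounds\<close>

lemma mean_le_\<gamma>:
  assumes D: "(offspring {k\<^sub>0, k\<^sub>1} ^^ n) {#0#} \<zeta>" and n: "1 \<le> n"
    and k: "exp b\<^sub>0 = real k\<^sub>0" "exp b\<^sub>1 = real k\<^sub>1" "even k\<^sub>0" "even k\<^sub>1" "2 \<le> k\<^sub>0" "k\<^sub>0 < k\<^sub>1"
    and b: "b\<^sub>0 \<le> b" "b \<le> b\<^sub>1" "real (size \<zeta>) = exp (b * real n)"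
  shows "sum_mset \<zeta> / real (size \<zeta>) / real n \<le> \<gamma> b\<^sub>0 b\<^sub>1 b"
proof (cases "b = b\<^sub>0")
  case True
  have "real (size \<zeta>) = exp b\<^sub>0 ^ n"
    using b(3) True by (simp add: exp_of_nat2_mult)
  then have "real (size \<zeta>) = real (k\<^sub>0 ^ n)" using k by simp
  then have "size \<zeta> = k\<^sub>0 ^ n" by (simp only: of_nat_eq_iff)
  moreover have "k\<^sub>0 ^ n \<le> size \<zeta> \<and> (size \<zeta> = k\<^sub>0 ^ n \<longrightarrow> sum_mset \<zeta> = 0)"
    using k by (intro descendants_size_sum[OF D]) auto
  ultimately show ?thesis using True by (simp add: \<gamma>_def)
next
  case False
  then have b': "b\<^sub>0 < b" using b by simp
  define m where "m = sum_mset \<zeta> / real (size \<zeta>) / real n"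
  have S: "0 < real (size \<zeta>)" unfolding b(3) by simp
  have mS: "sum_mset \<zeta> = m * real n * real (size \<zeta>)"
    using S n by (auto simp: m_def)
  \<comment> \<open>Steps of unit length bound the speed by 1, as \<open>le_if_legendre_le\<close>
    requires.\<close>
  have "sum_mset \<zeta> \<le> real (size \<zeta>) * real n"
    using descendants_le[OF D] by (rule sum_mset_le_size)
  then have "m * (real n * real (size \<zeta>)) \<le> 1 * (real n * real (size \<zeta>))"
    unfolding mS by (simp only: mult_ac mult_1_left)
  then have "m \<le> 1"
    using S n by (subst (asm) mult_le_cancel_right_pos) auto
  moreover have "\<theta> * m \<le> (b\<^sub>1 - b) + ln (cosh \<theta>)" for \<theta>
  proof -
    \<comment> \<open>\<open>m * n\<close> is the mean position, so the linear term of the tangent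
      bound disappears.\<close>
    have "exp (\<theta> * (m * real n)) * real (size \<zeta>) \<le> (\<Sum>x\<in>#\<zeta>. exp (\<theta> * x))"
      using sum_mset_exp_ge[of \<theta> "m * real n" \<zeta>] by (simp add: mS)
    also have "\<dots> \<le> (real k\<^sub>1 * cosh \<theta>) ^ n"
      using k by (intro descendants_exp_sum[OF D]) auto
    also have "real k\<^sub>1 * cosh \<theta> = exp (b\<^sub>1 + ln (cosh \<theta>))"
      using k by (simp add: exp_add cosh_real_pos)
    also have "exp (b\<^sub>1 + ln (cosh \<theta>)) ^ n = exp (real n * (b\<^sub>1 + ln (cosh \<theta>)))"
      by (rule exp_of_nat_mult[symmetric])
    also have "exp (\<theta> * (m * real n)) * real (size \<zeta>) = exp (real n * (\<theta> * m + b))"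
      unfolding b(3) exp_add[symmetric] by (simp only: algebra_simps)
    finally have "real n * (\<theta> * m + b) \<le> real n * (b\<^sub>1 + ln (cosh \<theta>))" by (simp only: exp_le_cancel_iff)
    then have "\<theta> * m + b \<le> b\<^sub>1 + ln (cosh \<theta>)" using n by (subst (asm) mult_le_cancel_left_pos) auto
    then show ?thesis by simp
  qed
  ultimately show ?thesis
    using le_if_legendre_le[OF \<gamma>_props[OF b' b(2)]] unfolding m_def by blast
qed

text \<open>To exponential order the full tree has \<open>exp (L * (b\<^sub>1 - \<beta> x))\<close>
  particles at slope \<open>x\<close>; \<open>\<delta>\<close> pays for rounding the slope and for
  the Stirling error.\<close>

lemma eventually_many_at_slope:
  fixes x b b\<^sub>1 \<delta> :: real and k :: nat
  assumes "0 \<le> x" "x \<le> 1" "\<beta> x \<le> b\<^sub>1 - b" "exp b\<^sub>1 = real k" "even k" "0 < \<delta>"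
  shows "\<forall>\<^sub>F L in sequentially. \<exists>j\<le>L. x * real L \<le> 2 * real j - real L \<and>
    exp (real L * (b - \<delta>)) \<le> real ((k div 2) ^ L * (L choose j))"
proof -
  \<comment> \<open>Rounding up keeps the realised slope \<open>y L\<close> at or above
    \<open>x\<close>; it stays at most 1 because \<open>(1 + x) * L / 2\<close> is at most the
    integer \<open>L\<close>.\<close>
  define j where "j L = nat \<lceil>(1 + x) * real L / 2\<rceil>" for L :: nat
  define y where "y L = 2 * real (j L) / real L - 1" for L
  have j_ge: "(1 + x) * real L / 2 \<le> real (j L)" for L
    unfolding j_def by (rule real_nat_ceiling_ge)
  have j_le: "real (j L) \<le> (1 + x) * real L / 2 + 1" for L
    using assms of_int_ceiling_le_add_one[of "(1 + x) * real L / 2"] by (simp add: j_def)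
  have jL: "j L \<le> L" for L
  proof -
    have "(1 + x) * real L / 2 \<le> real L" using assms mult_right_mono[of "1 + x" 2 "real L"] by simp
    then show ?thesis unfolding j_def by (simp add: ceiling_le_iff nat_le_iff)
  qed
  have y_ge: "x \<le> y L" and y_le_1: "y L \<le> 1" if "L > 0" for L
    using j_ge[of L] jL[of L] that by (auto simp: y_def field_simps)
  have y_le: "y L \<le> x + 2 / real L" if "L > 0" for L
  proof -
    have "2 * real (j L) / real L \<le> ((1 + x) * real L + 2) / real L"
      using j_le[of L] by (intro divide_right_mono) auto
    then show ?thesis using that by (simp add: y_def add_divide_distrib)
  qed
  have "y \<longlonglongrightarrow> x"
  proof (rule tendsto_sandwich)
    show "\<forall>\<^sub>F L in sequentially. x \<le> y L" "\<forall>\<^sub>F L in sequentially. y L \<le> x + 2 / real L"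
      using y_ge y_le by (auto intro: eventually_sequentiallyI[of 1])
    show "(\<lambda>L. x + 2 / real L) \<longlonglongrightarrow> x" by real_asymp
  qed auto
  then have "(\<lambda>L. \<beta> (y L)) \<longlonglongrightarrow> \<beta> x"
    using assms y_ge y_le_1
    by (intro continuous_on_tendsto_compose[OF continuous_on_\<beta>])
       (auto intro!: eventually_sequentiallyI[of 1] intro: order.trans)
  moreover have "(\<lambda>L. (2 + 2 * ln (real L)) / real L) \<longlonglongrightarrow> 0" by real_asymp
  ultimately have "(\<lambda>L. b\<^sub>1 - \<beta> (y L) - (2 + 2 * ln (real L)) / real L) \<longlonglongrightarrow> b\<^sub>1 - \<beta> x - 0"
    by (intro tendsto_intros)
  moreover have "b - \<delta> < b\<^sub>1 - \<beta> x - 0" using assms by simp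
  ultimately have "\<forall>\<^sub>F L in sequentially. b - \<delta> < b\<^sub>1 - \<beta> (y L) - (2 + 2 * ln (real L)) / real L"
    by (rule order_tendstoD)
  then show ?thesis
    using eventually_gt_at_top[of 0]
  proof eventually_elim
    case (elim L)
    have "k > 0" using assms(4) by (metis exp_gt_zero of_nat_0_less_iff)
    then have k: "real (k div 2) > 0" "real k = 2 * real (k div 2)"
      using assms(5) by (auto simp: real_of_nat_div)
    \<comment> \<open>The \<open>ln 2\<close> split off here becomes the leading term of
      \<open>ln_binomial_ge\<close>.\<close>
    have b1: "b\<^sub>1 = ln 2 + ln (real (k div 2))"
      using k assms(4) by (metis ln_exp ln_mult_pos zero_less_numeral)
    have c: "0 < real (L choose j L)" using jL[of L] by (simp add: zero_less_binomial)
    have "real L * (b - \<delta>) \<le> real L * (b\<^sub>1 - \<beta> (y L) - (2 + 2 * ln (real L)) / real L)"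
      using elim by (intro mult_left_mono) auto
    also have "\<dots> = real L * ln (real (k div 2)) + (real L * (ln 2 - \<beta> (y L)) - 2 - 2 * ln (real L))"
      using elim by (simp add: b1 field_simps)
    also have "\<dots> \<le> real L * ln (real (k div 2)) + ln (real (L choose j L))"
      using ln_binomial_ge[OF jL[of L]] elim by (simp add: y_def)
    also have "\<dots> = ln (real ((k div 2) ^ L * (L choose j L)))"
      using k c by (simp add: ln_mult ln_realpow)
    finally have "exp (real L * (b - \<delta>)) \<le> exp (ln (real ((k div 2) ^ L * (L choose j L))))" by simp
    also have "\<dots> = real ((k div 2) ^ L * (L choose j L))"
      using k c by (intro exp_ln) simp
    finally have "exp (real L * (b - \<delta>)) \<le> real ((k div 2) ^ L * (L choose j L))" .
    moreover have "x * real L \<le> 2 * real (j L) - real L"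
      using j_ge[of L] by (simp add: field_simps)
    ultimately show ?case using jL by blast
  qed
qed

text \<open>
  With sizes \<open>S\<^sub>t\<close> and defects \<open>u\<^sub>t = \<langle>\<zeta>\<^sub>t, x\<rangle> - s t S\<^sub>t\<close>, a block gives \<open>S\<^sub>t\<^sub>+\<^sub>1 = r S\<^sub>t + \<kappa> q\<^sup>t\<close> and
  \<open>u\<^sub>t\<^sub>+\<^sub>1 \<ge> r u\<^sub>t - \<kappa> L (t + 2) q\<^sup>t\<close>; the correction terms in \<open>q\<^sup>t\<close> make the two bounds inductive,
  using only \<open>r \<ge> q + 1\<close>.
\<close>

lemma block_construction:
  fixes A I :: "real multiset" and s :: real
  assumes D: "(offspring K ^^ L) {#0#} (A + I)"
    and k: "k \<in> K" "even k" "k ^ L < size A"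
    and A: "sum_mset A = real (size A) * s" and I: "- real L * real (size I) \<le> sum_mset I"
    and s: "0 \<le> s" "s \<le> real L"
  defines "r \<equiv> real (size A)" and "q \<equiv> real k ^ L" and "\<kappa> \<equiv> real (size I)"
  defines "E \<equiv> \<kappa> * real L"
  defines "C \<equiv> 2 * \<kappa> * real L + q * E"
  shows "\<exists>\<zeta>. (offspring K ^^ (L * t)) {#0#} \<zeta> \<and> r ^ t \<le> real (size \<zeta>) \<and>
    real (size \<zeta>) \<le> (1 + \<kappa>) * r ^ t - \<kappa> * q ^ t \<and>
    - C * r ^ t + q ^ t * (C + E * real t) \<le> sum_mset \<zeta> - s * real t * real (size \<zeta>)"
proof (induction t)
  \<comment> \<open>For a single particle at 0 all three bounds are equalities.\<close>
  case 0
  then show ?case by auto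
next
  case (Suc t)
  then obtain \<zeta> where \<zeta>: "(offspring K ^^ (L * t)) {#0#} \<zeta>" "r ^ t \<le> real (size \<zeta>)"
    "real (size \<zeta>) \<le> (1 + \<kappa>) * r ^ t - \<kappa> * q ^ t"
    "- C * r ^ t + q ^ t * (C + E * real t) \<le> sum_mset \<zeta> - s * real t * real (size \<zeta>)" by blast
  have rq: "q + 1 \<le> r"
  proof -
    have "real (k ^ L + 1) \<le> real (size A)" using k(3) by (intro of_nat_mono) simp
    then show ?thesis by (simp add: r_def q_def)
  qed
  have nn: "0 \<le> q" "0 \<le> \<kappa>" "0 \<le> r" "0 \<le> E" "0 \<le> C"
    by (auto simp: q_def \<kappa>_def r_def E_def C_def)
  \<comment> \<open>The new block is put at the root: each kept particle then continues with a copy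
    of the \<open>t\<close>-block configuration.\<close>
  obtain A' where A': "(offspring K ^^ (L * t)) A A'" "size A' = size A * size \<zeta>"
     "sum_mset A' = real (size \<zeta>) * sum_mset A + real (size A) * sum_mset \<zeta>"
    using descendants_independent_copies[OF \<zeta>(1), of A] by blast
  \<comment> \<open>The remaining particles grow full \<open>k\<close>-ary trees, which multiply
    their mass by \<open>q ^ t\<close> and leave their mean unchanged.\<close>
  obtain I' where I': "(offspring K ^^ (L * t)) I I'" "size I' = size I * k ^ (L * t)"
     "sum_mset I' = real k ^ (L * t) * sum_mset I"
    using descendants_independent_copies[OF descendants_full_step[OF k(1), of "L * t" "{#0#}"], of I]
      size_full_steps[OF k(2)] sum_mset_full_steps[OF k(2)] by auto
  have d: "(offspring K ^^ (L * Suc t)) {#0#} (A' + I')"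
    using descendants_add[OF D descendants_union[OF A'(1) I'(1)]] by simp
  have sz: "real (size (A' + I')) = r * real (size \<zeta>) + \<kappa> * q ^ t"
    using A'(2) I'(2) by (simp add: r_def \<kappa>_def q_def power_mult)
  have sm: "sum_mset (A' + I') = r * (s * real (size \<zeta>) + sum_mset \<zeta>) + q ^ t * sum_mset I"
    using A'(3) I'(3) A by (simp add: r_def q_def power_mult algebra_simps)
  show ?case
  proof (intro exI conjI)
    show "(offspring K ^^ (L * Suc t)) {#0#} (A' + I')" by fact
    have "r * r ^ t \<le> r * real (size \<zeta>)" using \<zeta>(2) nn by (intro mult_left_mono) auto
    moreover have "0 \<le> \<kappa> * q ^ t" using nn by simp
    ultimately show "r ^ Suc t \<le> real (size (A' + I'))" unfolding sz by simp
    have "r * real (size \<zeta>) \<le> r * ((1 + \<kappa>) * r ^ t - \<kappa> * q ^ t)"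
      using \<zeta>(3) nn by (intro mult_left_mono) auto
    \<comment> \<open>Here \<open>q + 1 \<le> r\<close> absorbs the newly discarded mass
      \<open>\<kappa> * q ^ t\<close> into the correction term.\<close>
    moreover have "\<kappa> * q ^ t * (q + 1) \<le> \<kappa> * q ^ t * r"
      using rq nn by (intro mult_left_mono) auto
    ultimately show "real (size (A' + I')) \<le> (1 + \<kappa>) * r ^ Suc t - \<kappa> * q ^ Suc t"
      unfolding sz by (simp add: algebra_simps)
    have 1: "r * (- C * r ^ t + q ^ t * (C + E * real t)) \<le>
        r * (sum_mset \<zeta> - s * real t * real (size \<zeta>))"
      using \<zeta>(4) nn by (intro mult_left_mono) auto
    \<comment> \<open>First loss: discarded particles may sit as low as \<open>- L\<close>.\<close>
    have "q ^ t * (- real L * \<kappa>) \<le> q ^ t * sum_mset I"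
      using I nn by (intro mult_left_mono) (auto simp: \<kappa>_def)
    then have 2: "- (q ^ t * E) \<le> q ^ t * sum_mset I" by (simp add: E_def algebra_simps)
    \<comment> \<open>Second loss: their mass is charged with the target position
      \<open>s * Suc t\<close>.\<close>
    have "s * (real (Suc t) * (\<kappa> * q ^ t)) \<le> real L * (real (Suc t) * (\<kappa> * q ^ t))"
      using s nn by (intro mult_right_mono) auto
    then have 3: "s * real (Suc t) * (\<kappa> * q ^ t) \<le> q ^ t * E * real (Suc t)"
      by (simp add: E_def algebra_simps)
    have "q ^ t * (C + E * real t) * (q + 1) \<le> q ^ t * (C + E * real t) * r"
      using rq nn by (intro mult_left_mono) auto
    \<comment> \<open>This value of \<open>C\<close> balances both losses,
      \<open>q ^ t * E * (t + 2)\<close> together, and the increment \<open>q ^ Suc t * E\<close> of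
      the correction term.\<close>
    moreover have "C = 2 * E + q * E" by (simp add: C_def E_def)
    ultimately have 4: "q ^ Suc t * (C + E * real (Suc t)) + q ^ t * E * (real t + 2) \<le>
        q ^ t * (C + E * real t) * r"
      by (simp add: algebra_simps)
    have "- C * r ^ Suc t + q ^ Suc t * (C + E * real (Suc t)) \<le>
        r * (sum_mset \<zeta> - s * real t * real (size \<zeta>)) - q ^ t * E * (real t + 2)"
      using 1 4 by (simp add: algebra_simps)
    also have "\<dots> \<le> sum_mset (A' + I') - s * real (Suc t) * real (size (A' + I'))"
      unfolding sz sm using 2 3 by (simp add: algebra_simps)
    finally show "- C * r ^ Suc t + q ^ Suc t * (C + E * real (Suc t)) \<le>
      sum_mset (A' + I') - s * real (Suc t) * real (size (A' + I'))" .
  qed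
qed

text \<open>The choices are made in the order \<open>\<delta>\<close>, then \<open>L\<close> and
  \<open>j\<close>, then \<open>t\<close>: the constants \<open>\<kappa>\<close> and
  \<open>C\<close> depend on the block, and \<open>t\<close> has to beat them.\<close>

lemma ex_mean_ge_\<gamma>:
  assumes k: "exp b\<^sub>0 = real k\<^sub>0" "exp b\<^sub>1 = real k\<^sub>1" "even k\<^sub>0" "even k\<^sub>1" "2 \<le> k\<^sub>0" "k\<^sub>0 < k\<^sub>1"
    and b: "b\<^sub>0 \<le> b" "b \<le> b\<^sub>1" and \<epsilon>: "0 < \<epsilon>"
  shows "\<exists>n\<ge>1. \<exists>\<zeta>. (offspring {k\<^sub>0, k\<^sub>1} ^^ n) {#0#} \<zeta> \<and>
    \<gamma> b\<^sub>0 b\<^sub>1 b - \<epsilon> \<le> sum_mset \<zeta> / real (size \<zeta>) / real n \<and>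
    ln (real (size \<zeta>)) / real n \<in> {b - \<epsilon>..b + \<epsilon>}"
proof (cases "b = b\<^sub>0")
  case True
  have "(offspring {k\<^sub>0, k\<^sub>1} ^^ 1) {#0#} ((full_step k\<^sub>0 ^^ 1) {#0#})"
    by (rule descendants_full_step) simp
  moreover have "real (size ((full_step k\<^sub>0 ^^ 1) {#0#})) = exp b\<^sub>0"
    using size_full_steps[OF k(3), of 1 "{#0#}"] k(1) by simp
  ultimately show ?thesis
    using sum_mset_full_steps[OF k(3), of 1] True \<epsilon>
    by (intro exI[of _ 1] conjI exI[of _ "(full_step k\<^sub>0 ^^ 1) {#0#}"]) (auto simp: \<gamma>_def)
next
  case False
  then have b0: "b\<^sub>0 < b" using b by simp
  define x where "x = \<gamma> b\<^sub>0 b\<^sub>1 b"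
  have x: "0 \<le> x" "x \<le> 1" "\<beta> x \<le> b\<^sub>1 - b"
    using \<gamma>_props[OF b0 b(2)] by (auto simp: x_def)
  \<comment> \<open>Half the gap keeps \<open>b - \<delta>\<close> above \<open>b\<^sub>0\<close>,
    so that the kept particles outnumber \<open>k\<^sub>0 ^ L\<close>.\<close>
  define \<delta> where "\<delta> = min \<epsilon> ((b - b\<^sub>0) / 2)"
  have \<delta>: "0 < \<delta>" "\<delta> \<le> \<epsilon>" "b\<^sub>0 < b - \<delta>" using b0 \<epsilon> by (auto simp: \<delta>_def min_def field_simps)
  \<comment> \<open>Rounding \<open>r\<close> up to an integer costs at most a factor 2, hence
    \<open>ln 2\<close> per block of length \<open>L\<close>.\<close>
  have "(\<lambda>L. ln 2 / real L) \<longlonglongrightarrow> 0" by real_asymp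
  then have "\<forall>\<^sub>F L in sequentially. ln 2 / real L < \<epsilon>" using \<epsilon> by (rule order_tendstoD)
  with eventually_many_at_slope[OF x k(2,4) \<delta>(1)] eventually_gt_at_top[of 0]
  have ev: "\<forall>\<^sub>F L in sequentially. 0 < L \<and> ln 2 / real L < \<epsilon> \<and> (\<exists>j\<le>L. x * real L \<le> 2 * real j - real L \<and>
    exp (real L * (b - \<delta>)) \<le> real ((k\<^sub>1 div 2) ^ L * (L choose j)))"
    by eventually_elim auto
  then obtain L j where L: "0 < L" "ln 2 / real L < \<epsilon>" and j: "j \<le> L" "x * real L \<le> 2 * real j - real L"
    and many: "exp (real L * (b - \<delta>)) \<le> real ((k\<^sub>1 div 2) ^ L * (L choose j))"
    using eventually_happens'[OF sequentially_bot ev] by blast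
  define s where "s = 2 * real j - real L"
  define r where "r = nat \<lceil>exp (real L * (b - \<delta>))\<rceil>"
  let ?\<zeta> = "(full_step k\<^sub>1 ^^ L) {#0#}"
  define A where "A = replicate_mset r s"
  define I where "I = ?\<zeta> - A"
  have r_ge: "exp (real L * (b - \<delta>)) \<le> real r"
    unfolding r_def by (rule real_nat_ceiling_ge)
  have e1: "1 \<le> exp (real L * (b - \<delta>))"
  proof -
    have "1 < exp b\<^sub>0" using k(1,5) by simp
    then have "0 < b\<^sub>0" by simp
    then have "0 \<le> real L * (b - \<delta>)" using \<delta> by (intro mult_nonneg_nonneg) auto
    then show ?thesis by simp
  qed
  have r_le: "real r \<le> 2 * exp (real L * (b - \<delta>))"
  proof -
    have "real r = of_int \<lceil>exp (real L * (b - \<delta>))\<rceil>" by (simp add: r_def)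
    then show ?thesis
      using e1 of_int_ceiling_le_add_one[of "exp (real L * (b - \<delta>))"] by linarith
  qed
  have "r \<le> (k\<^sub>1 div 2) ^ L * (L choose j)"
    using many by (simp add: r_def nat_le_iff ceiling_le_iff)
  also have "\<dots> \<le> count ?\<zeta> s" unfolding s_def by (rule count_full_steps)
  finally have "A \<subseteq># ?\<zeta>" unfolding A_def by (simp add: count_le_replicate_mset_subset_eq)
  then have AI: "A + I = ?\<zeta>" by (simp add: I_def)
  have D: "(offspring {k\<^sub>0, k\<^sub>1} ^^ L) {#0#} (A + I)"
    unfolding AI by (rule descendants_full_step) simp
  have "- real L \<le> y" if "y \<in># I" for y
    using that unfolding I_def by (rule full_steps_ge[OF in_diffD])
  then have I: "- real L * real (size I) \<le> sum_mset I"
    using sum_mset_ge_size[of I "- real L"] by (simp add: mult.commute)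
  have kr: "k\<^sub>0 ^ L < size A"
  proof -
    have "real (k\<^sub>0 ^ L) = exp (real L * b\<^sub>0)" using k(1) by (simp add: exp_of_nat_mult)
    also have "\<dots> < exp (real L * (b - \<delta>))" using \<delta> L by simp
    also have "\<dots> \<le> real (size A)" using r_ge by (simp add: A_def)
    finally show ?thesis by (simp only: of_nat_less_iff)
  qed
  have s: "0 \<le> s" "s \<le> real L"
  proof -
    have "0 \<le> x * real L" using x by simp
    then show "0 \<le> s" using j by (simp add: s_def)
    show "s \<le> real L" using j by (simp add: s_def)
  qed
  define \<kappa> where "\<kappa> = real (size I)"
  define E where "E = \<kappa> * real L"
  define C where "C = 2 * \<kappa> * real L + real k\<^sub>0 ^ L * E"
  have nn: "0 \<le> \<kappa>" "0 \<le> E" "0 \<le> C" by (auto simp: \<kappa>_def E_def C_def)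
  \<comment> \<open>Makes both the size factor \<open>1 + \<kappa>\<close> and the defect
    \<open>C\<close> negligible per block.\<close>
  obtain t :: nat where t: "max 1 (max (ln (1 + \<kappa>) / \<delta>) (C / \<epsilon>)) \<le> real t"
    using real_arch_simple by blast
  then have t': "1 \<le> t" "ln (1 + \<kappa>) \<le> \<delta> * real t" "C \<le> \<epsilon> * real t"
    using \<delta> \<epsilon> by (auto simp: field_simps)
  have sizeA: "size A = r" and sumA: "sum_mset A = real (size A) * s" by (simp_all add: A_def)
  obtain \<zeta> where \<zeta>: "(offspring {k\<^sub>0, k\<^sub>1} ^^ (L * t)) {#0#} \<zeta>" "real r ^ t \<le> real (size \<zeta>)"
    "real (size \<zeta>) \<le> (1 + \<kappa>) * real r ^ t - \<kappa> * (real k\<^sub>0 ^ L) ^ t"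
    "- C * real r ^ t + (real k\<^sub>0 ^ L) ^ t * (C + E * real t) \<le> sum_mset \<zeta> - s * real t * real (size \<zeta>)"
    using block_construction[OF D insertI1 k(3) kr sumA I s, of t, unfolded sizeA,
      folded \<kappa>_def, folded E_def, folded C_def] by blast
  have r0: "0 < real r" using r_ge e1 by linarith
  have S: "0 < real (size \<zeta>)" using \<zeta>(2) zero_less_power[OF r0, of t] by linarith
  have lnr: "real L * (b - \<delta>) \<le> ln (real r)" "ln (real r) \<le> ln 2 + real L * (b - \<delta>)"
  proof -
    show "real L * (b - \<delta>) \<le> ln (real r)" using r_ge r0 by (simp add: ln_ge_iff)
    have "ln (real r) \<le> ln (2 * exp (real L * (b - \<delta>)))" using r_le r0 by (intro ln_mono) auto
    then show "ln (real r) \<le> ln 2 + real L * (b - \<delta>)" by (simp add: ln_mult)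
  qed
  have Lt: "0 < real (L * t)" using L t' by simp
  show ?thesis
  proof (intro exI conjI)
    show "1 \<le> L * t" using L t' by simp
    show "(offspring {k\<^sub>0, k\<^sub>1} ^^ (L * t)) {#0#} \<zeta>" by fact
    have "(x - \<epsilon>) * real (L * t) \<le> sum_mset \<zeta> / real (size \<zeta>)"
    proof -
      have "0 \<le> (real k\<^sub>0 ^ L) ^ t * (C + E * real t)" using nn by simp
      moreover have "C * real r ^ t \<le> C * real (size \<zeta>)" using \<zeta>(2) nn by (intro mult_left_mono)
      ultimately have "(s * real t - C) * real (size \<zeta>) \<le> sum_mset \<zeta>"
        using \<zeta>(4) by (simp add: algebra_simps)
      then have "s * real t - C \<le> sum_mset \<zeta> / real (size \<zeta>)" using S by (simp only: pos_le_divide_eq)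
      moreover have "x * real L * real t \<le> s * real t"
        using j by (intro mult_right_mono) (auto simp: s_def)
      moreover have "\<epsilon> * real t * 1 \<le> \<epsilon> * real t * real L" using L \<epsilon> by (intro mult_left_mono) auto
      ultimately show ?thesis using t'(3) by (simp add: algebra_simps)
    qed
    then show "\<gamma> b\<^sub>0 b\<^sub>1 b - \<epsilon> \<le> sum_mset \<zeta> / real (size \<zeta>) / real (L * t)"
      using Lt by (simp only: x_def pos_le_divide_eq)
    have "(b - \<epsilon>) * real (L * t) \<le> ln (real (size \<zeta>))"
    proof -
      have "(b - \<epsilon>) * real (L * t) \<le> (b - \<delta>) * real (L * t)" using \<delta> by (intro mult_right_mono) auto
      also have "\<dots> = real t * (real L * (b - \<delta>))" by simp
      also have "\<dots> \<le> real t * ln (real r)" using lnr by (intro mult_left_mono) auto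
      also have "\<dots> = ln (real r ^ t)" using r0 by (simp add: ln_realpow)
      also have "\<dots> \<le> ln (real (size \<zeta>))" using \<zeta>(2) r0 by (intro ln_mono) auto
      finally show ?thesis .
    qed
    moreover have "ln (real (size \<zeta>)) \<le> (b + \<epsilon>) * real (L * t)"
    proof -
      have "0 \<le> \<kappa> * (real k\<^sub>0 ^ L) ^ t" using nn by simp
      then have "real (size \<zeta>) \<le> (1 + \<kappa>) * real r ^ t" using \<zeta>(3) by linarith
      then have "ln (real (size \<zeta>)) \<le> ln ((1 + \<kappa>) * real r ^ t)" using S by (intro ln_mono) auto
      also have "\<dots> = ln (1 + \<kappa>) + real t * ln (real r)" using r0 nn by (simp add: ln_mult ln_realpow)
      also have "\<dots> \<le> \<delta> * real t + real t * (ln 2 + real L * (b - \<delta>))"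
        using t' lnr by (intro add_mono mult_left_mono) auto
      \<comment> \<open>The first \<open>\<delta>\<close> cancels the one in the rate
        \<open>b - \<delta>\<close>, and \<open>\<epsilon>\<close> pays for the rounding of
        \<open>r\<close>.\<close>
      also have "\<dots> \<le> \<delta> * real t * real L + real t * (\<epsilon> * real L + real L * (b - \<delta>))"
      proof (intro add_mono mult_left_mono)
        have "\<delta> * real t * 1 \<le> \<delta> * real t * real L" using L \<delta> by (intro mult_left_mono) auto
        then show "\<delta> * real t \<le> \<delta> * real t * real L" by simp
        show "ln 2 \<le> \<epsilon> * real L" using L by (simp add: field_simps)
      qed auto
      also have "\<dots> = (b + \<epsilon>) * real (L * t)" by (simp add: algebra_simps)
      finally show ?thesis .
    qed
    ultimately show "ln (real (size \<zeta>)) / real (L * t) \<in> {b - \<epsilon>..b + \<epsilon>}"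
      using Lt by (simp only: atLeastAtMost_iff pos_le_divide_eq pos_divide_le_eq)
  qed
qed

theorem proposition1p4:
  fixes p b\<^sub>0 b\<^sub>1 :: real
    and k\<^sub>0 k\<^sub>1 :: nat
    and N :: "nat pmf"
    and M :: "'w measure"
    and Z :: "nat \<Rightarrow> 'w \<Rightarrow> real multiset"
  assumes "0 < p" "p < 1"
    and "exp b\<^sub>0 = real k\<^sub>0" "exp b\<^sub>1 = real k\<^sub>1"
    and "even k\<^sub>0" "even k\<^sub>1" "2 \<le> k\<^sub>0" "k\<^sub>0 < k\<^sub>1"
    and "pmf N k\<^sub>0 = p" "pmf N k\<^sub>1 = 1 - p"
    and "branching_random_walk M (balanced_reproduction N) Z"
  shows "(\<forall>b\<in>{b\<^sub>0..b\<^sub>1}. \<forall>n\<ge>1. \<forall>\<zeta>\<in>attainable_of_rate M Z n b.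
            first_moment (normalized (atoms_measure \<zeta>)) / real n \<le> \<gamma> b\<^sub>0 b\<^sub>1 b) \<and>
         (\<forall>\<epsilon>>0. \<forall>b\<in>{b\<^sub>0..b\<^sub>1}. \<exists>n\<ge>1. \<exists>\<zeta>\<in>attainable M Z n.
            first_moment (normalized (atoms_measure \<zeta>)) / real n \<ge> \<gamma> b\<^sub>0 b\<^sub>1 b - \<epsilon> \<and>
            ln (total_mass (atoms_measure \<zeta>)) / real n \<in> {b - \<epsilon>..b + \<epsilon>})"
proof -
  have "set_pmf N = {k\<^sub>0, k\<^sub>1}"
    using assms by (intro set_pmf_two_points) auto
  then have att: "attainable M Z n = {\<zeta>. (offspring {k\<^sub>0, k\<^sub>1} ^^ n) {#0#} \<zeta>}" for n
    using attainable_balanced_reproduction[OF assms(11)] by simp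
  have mean: "first_moment (normalized (atoms_measure \<zeta>)) = sum_mset \<zeta> / real (size \<zeta>)"
    if "\<zeta> \<in> attainable M Z n" for \<zeta> n
  \<comment> \<open>Normalisation needs a nonempty configuration; the minimal size
    \<open>k\<^sub>0 ^ n\<close> is positive.\<close>
  proof (rule first_moment_normalized_atoms_measure)
    have "k\<^sub>0 ^ n \<le> size \<zeta> \<and> (size \<zeta> = k\<^sub>0 ^ n \<longrightarrow> sum_mset \<zeta> = 0)"
      using that assms by (intro descendants_size_sum[of n "{k\<^sub>0, k\<^sub>1}"]) (auto simp: att)
    moreover have "0 < k\<^sub>0 ^ n" using assms by simp
    ultimately show "\<zeta> \<noteq> {#}" by auto
  qed
  show ?thesis
  proof (intro conjI ballI allI impI)
    fix b n \<zeta> assume b: "b \<in> {b\<^sub>0..b\<^sub>1}" and n: "1 \<le> n" and \<zeta>: "\<zeta> \<in> attainable_of_rate M Z n b"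
    then have "\<zeta> \<in> attainable M Z n" "real (size \<zeta>) = exp (b * real n)"
      by (auto simp: attainable_of_rate_def total_mass_atoms_measure)
    then show "first_moment (normalized (atoms_measure \<zeta>)) / real n \<le> \<gamma> b\<^sub>0 b\<^sub>1 b"
      using mean_le_\<gamma>[OF _ n assms(3-8), of \<zeta> b] b by (simp add: mean att del: One_nat_def)
  next
    fix \<epsilon> b :: real assume "0 < \<epsilon>" "b \<in> {b\<^sub>0..b\<^sub>1}"
    then obtain n \<zeta> where n: "n \<ge> 1" and \<zeta>: "\<zeta> \<in> attainable M Z n" and le:
      "\<gamma> b\<^sub>0 b\<^sub>1 b - \<epsilon> \<le> sum_mset \<zeta> / real (size \<zeta>) / real n"
      "ln (real (size \<zeta>)) / real n \<in> {b - \<epsilon>..b + \<epsilon>}"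
      using ex_mean_ge_\<gamma>[OF assms(3-8), of b \<epsilon>] unfolding att mem_Collect_eq atLeastAtMost_iff
      by blast
    show "\<exists>n\<ge>1. \<exists>\<zeta>\<in>attainable M Z n.
        first_moment (normalized (atoms_measure \<zeta>)) / real n \<ge> \<gamma> b\<^sub>0 b\<^sub>1 b - \<epsilon> \<and>
        ln (total_mass (atoms_measure \<zeta>)) / real n \<in> {b - \<epsilon>..b + \<epsilon>}"
      using le by (intro exI[of _ n] conjI n bexI[OF _ \<zeta>])
        (simp_all only: mean[OF \<zeta>] total_mass_atoms_measure)
  qed
qed

end
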